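(* Let $d\ge3$ and let $\mathbf X=(X_t)_{t\ge0}$ be an isotropic unimodal Lévy process in $\mathbb R^d$ with Lévy–Khintchine exponent $\psi$ and potential measure $G$. Assume that $\psi\in\mathcal R^0_\alpha$ for some $\alpha\in[0,2]$. Then $$\lim_{r\to+\infty}\psi(r^{-1})\,G(\{x:|x|\le r\})=\tilde{\mathcal C}_{d,\alpha},\qquad\text{where}\qquad \tilde{\mathcal C}_{d,\alpha}=2^{-\alpha}\frac{\Gamma((d-\alpha)/2)}{\Gamma(d/2)\,\Gamma(1+\alpha/2)}.$$
   Context: An isotropic Lévy process in $\mathbb R^d$ is a Lévy process $\mathbf X=(X_t)_{t\ge0}$ with $X_0=0$ a.s. such that each $X_t$ has a rotationally invariant distribution $p(t,dx)$. Its Lévy–Khintchine exponent $\psi$ is defined by $\int_{\mathbb R^d}e^{i\langle\xi,x\rangle}p(t,dx)=e^{-t\psi(\xi)}$, with $\psi(\xi)=\int_{\mathbb R^d}(1-\cos\langle\xi,x\rangle)\,\nu(dx)+\eta|\xi|^2$, where $\eta\ge0$ and $\nu$ is a rotationally invariant Lévy measure. The function $\psi$ is radial and one writes $\psi(r)=\psi(\xi)$ for $r=|\xi|$. A Borel measure is isotropic unimodal if it is absolutely continuous on $\mathbb R^d\setminus\{0\}$ with a radial, radially non-increasing density. $\mathbf X$ is isotropic unimodal if $p(t,dx)$ is isotropic unimodal for every $t>0$. The potential measure is $G(A)=\int_0^\infty\mathbb P(X_t\in A)\,dt$ for Borel $A\subset\mathbb R^d$ (the process is transient since $d\ge3$).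 Regular variation: $f:[x_0,+\infty)\to(0,+\infty)$, $x_0>0$, is in $\mathcal R^\infty_\alpha$ (regularly varying of index $\alpha$ at infinity) if $f(\lambda x)/f(x)\to\lambda^\alpha$ as $x\to+\infty$ for each $\lambda>0$. A function $f$, positive near zero, is in $\mathcal R^0_\alpha$ (regularly varying of index $\alpha$ at zero) if $x\mapsto f(x^{-1})^{-1}$ is in $\mathcal R^\infty_\alpha$, i.e. $f(\lambda x)/f(x)\to\lambda^\alpha$ as $x\to0^+$ for each $\lambda>0$. The condition $\psi\in\mathcal R^0_\alpha$ refers to $r\mapsto\psi(r)$. *)

theory Defs
  imports "HOL-Probability.Probability"
begin

section \<open>Levy processes\<close>

text \<open>Only times \<open>t \<ge> 0\<close> matter; the values of \<open>X\<close> at negative times are irrelevant.\<close>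

definition levy_process :: "'w measure \<Rightarrow> (real \<Rightarrow> 'w \<Rightarrow> 'a::euclidean_space) \<Rightarrow> bool" where
  "levy_process M X \<longleftrightarrow>
     prob_space M \<and>
     (\<forall>t\<ge>0. X t \<in> borel_measurable M) \<and>
     (AE \<omega> in M. X 0 \<omega> = 0) \<and>
     (\<forall>(n::nat) (t::nat \<Rightarrow> real). 0 \<le> t 0 \<and> mono t \<longrightarrow>
        prob_space.indep_vars M (\<lambda>_. borel) (\<lambda>i \<omega>. X (t (Suc i)) \<omega> - X (t i) \<omega>) {..<n}) \<and>
     (\<forall>s\<ge>0. \<forall>t\<ge>0. distr M borel (\<lambda>\<omega>. X (s + t) \<omega> - X s \<omega>) = distr M borel (X t)) \<and>
     (\<forall>t\<ge>0. \<forall>\<epsilon>>0.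
        ((\<lambda>s. measure M {\<omega> \<in> space M. norm (X s \<omega> - X t \<omega>) > \<epsilon>}) \<longlongrightarrow> 0) (at t within {0..})) \<and>
     (AE \<omega> in M. \<forall>t\<ge>0.
        ((\<lambda>s. X s \<omega>) \<longlongrightarrow> X t \<omega>) (at_right t) \<and>
        (t > 0 \<longrightarrow> (\<exists>l. ((\<lambda>s. X s \<omega>) \<longlongrightarrow> l) (at_left t))))"

text \<open>Rotational invariance is invariance under the full orthogonal group; in dimension at
  least two this is the same as invariance under rotations of determinant one.\<close>

definition rotation_invariant :: "'a::euclidean_space measure \<Rightarrow> bool" where
  "rotation_invariant \<mu> \<longleftrightarrow>
     sets \<mu> = sets borel \<and> (\<forall>T. orthogonal_transformation T \<longrightarrow> distr \<mu> borel T = \<mu>)"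

text \<open>The density is \<open>g \<circ> norm\<close>; an atom at the origin is allowed, and \<open>g 0\<close> is irrelevant.\<close>

definition isotropic_unimodal :: "'a::euclidean_space measure \<Rightarrow> bool" where
  "isotropic_unimodal \<mu> \<longleftrightarrow>
     sets \<mu> = sets borel \<and>
     (\<exists>g :: real \<Rightarrow> real.
        (\<forall>r>0. 0 \<le> g r) \<and> antimono_on {0<..} g \<and>
        (\<forall>A \<in> sets borel. 0 \<notin> A \<longrightarrow>
           emeasure \<mu> A = (\<integral>\<^sup>+x\<in>A. ennreal (g (norm x)) \<partial>lborel)))"

definition isotropic_levy_process :: "'w measure \<Rightarrow> (real \<Rightarrow> 'w \<Rightarrow> 'a::euclidean_space) \<Rightarrow> bool" where
  "isotropic_levy_process M X \<longleftrightarrow>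
     levy_process M X \<and> (\<forall>t\<ge>0. rotation_invariant (distr M borel (X t)))"

definition isotropic_unimodal_levy_process ::
    "'w measure \<Rightarrow> (real \<Rightarrow> 'w \<Rightarrow> 'a::euclidean_space) \<Rightarrow> bool" where
  "isotropic_unimodal_levy_process M X \<longleftrightarrow>
     isotropic_levy_process M X \<and> (\<forall>t>0. isotropic_unimodal (distr M borel (X t)))"

text \<open>For an isotropic process the exponent is real-valued, and this equation, required for all
  \<open>t \<ge> 0\<close>, determines it. That it has the form
  \<open>\<psi> \<xi> = (\<integral>x. 1 - cos (\<xi> \<bullet> x) \<partial>\<nu>) + \<eta> * (norm \<xi>)\<^sup>2\<close> with \<open>\<eta> \<ge> 0\<close> and a rotation invariant Levy
  measure \<open>\<nu>\<close> is the Levy--Khintchine theorem, hence is not repeated as a requirement.\<close>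

definition levy_khintchine_exponent ::
    "'w measure \<Rightarrow> (real \<Rightarrow> 'w \<Rightarrow> 'a::euclidean_space) \<Rightarrow> ('a \<Rightarrow> real) \<Rightarrow> bool" where
  "levy_khintchine_exponent M X \<psi> \<longleftrightarrow>
     (\<forall>t\<ge>0. \<forall>\<xi>. (CLINT x|distr M borel (X t). iexp (\<xi> \<bullet> x)) = exp (- of_real (t * \<psi> \<xi>)))"

text \<open>The function \<open>r \<mapsto> \<psi>(r)\<close> for a radial \<open>\<psi>\<close>; by radiality the choice of unit vector is
  irrelevant when \<open>r \<ge> 0\<close>.\<close>

definition radial_profile :: "('a::euclidean_space \<Rightarrow> real) \<Rightarrow> real \<Rightarrow> real" where
  "radial_profile f r = f (r *\<^sub>R (SOME e. norm e = 1))"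

definition potential_measure ::
    "'w measure \<Rightarrow> (real \<Rightarrow> 'w \<Rightarrow> 'a::euclidean_space) \<Rightarrow> 'a set \<Rightarrow> ennreal" where
  "potential_measure M X A = (\<integral>\<^sup>+t\<in>{0..}. emeasure (distr M borel (X t)) A \<partial>lborel)"

section \<open>Regular variation\<close>

definition regularly_varying_at_infinity :: "real \<Rightarrow> (real \<Rightarrow> real) \<Rightarrow> bool" where
  "regularly_varying_at_infinity \<alpha> f \<longleftrightarrow>
     (\<exists>x0>0. \<forall>x\<ge>x0. f x > 0) \<and>
     (\<forall>c>0. ((\<lambda>x. f (c * x) / f x) \<longlongrightarrow> c powr \<alpha>) at_top)"

definition regularly_varying_at_zero :: "real \<Rightarrow> (real \<Rightarrow> real) \<Rightarrow> bool" where
  "regularly_varying_at_zero \<alpha> f \<longleftrightarrow>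
     regularly_varying_at_infinity \<alpha> (\<lambda>x. inverse (f (inverse x)))"

end

theory Submission
  imports Defs
begin

text \<open>
  The measure \<open>G\<close> of balls is read off from its Gaussian transform. Let \<open>\<mu>\<close> be the image of \<open>G\<close> under
  \<open>x \<mapsto> |x|\<^sup>2\<close>, so that \<open>G {x. |x| \<le> r} = \<mu> {..r\<^sup>2}\<close>. Since \<open>x \<mapsto> exp (- a |x|\<^sup>2)\<close> is the
  characteristic function of \<open>sqrt (2 a) Y\<close> with \<open>Y\<close> standard Gaussian, Fubini turns
  \<open>E exp (- a |X t|\<^sup>2)\<close> into \<open>E exp (- t \<psi> (sqrt (2 a) Y))\<close>, and integrating over \<open>t\<close> gives
  the Laplace transform of \<open>\<mu>\<close> at \<open>a\<close>: it equals \<open>E (1 / \<psi> (sqrt (2 a) Y))\<close>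
  (\<open>radial_potential_measure_laplace\<close>).

  Put \<open>a = 1 / x\<close> with \<open>x \<rightarrow> \<infinity>\<close> and multiply by \<open>\<psi> (1 / sqrt x)\<close>. By regular variation the
  integrand converges to \<open>(sqrt 2 |Y|) powr (- \<alpha>)\<close>. As \<open>|Y|\<^sup>2 / 2\<close> has the Gamma distribution of
  shape \<open>d / 2\<close>, the expectation of this limit is
  \<open>2 powr (- \<alpha>) * Gamma ((d - \<alpha>) / 2) / Gamma (d / 2)\<close>. Karamata's Tauberian theorem then passes
  from the Laplace transform to \<open>\<mu> {..x}\<close> and contributes the factor \<open>1 / Gamma (1 + \<alpha> / 2)\<close>.

  Unimodality is what makes the limit and the expectation interchangeable. It implies that
  \<open>1 - E cos (\<xi> \<bullet> X t)\<close> is comparable to \<open>E min 1 ((\<xi> \<bullet> X t)\<^sup>2)\<close>, with constants depending only on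
  \<open>d\<close>. The latter is monotone and at most quadratic in \<open>|\<xi>|\<close>; dividing by \<open>t\<close> and letting
  \<open>t \<rightarrow> 0\<close> transfers both properties to \<open>\<psi>\<close>:
  \<open>\<psi> \<xi> \<le> C * max 1 (1 / u\<^sup>2) * \<psi> (u \<xi>)\<close> for every \<open>u > 0\<close>
  (\<open>levy_khintchine_exponent_almost_increasing\<close>). Hence the integrands are dominated by a multiple
  of \<open>1 + 1 / |Y|\<^sup>2\<close>, which is integrable exactly because \<open>d \<ge> 3\<close>.
\<close>

section \<open>Karamata's Tauberian theorem\<close>

text \<open>
  A continuous function of \<open>exp (- s)\<close>, multiplied by the weight \<open>exp (- s)\<close>, can be squeezed
  between two indicators. The weight has to be divided out, hence the denominator \<open>max x u\<close>, which
  equals \<open>x\<close> wherever the cutoff does not vanish.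
\<close>

lemma exp_weighted_cutoff:
  fixes a b :: real
  assumes "a < b"
  obtains p :: "real \<Rightarrow> real" where "continuous_on UNIV p"
    "\<And>s. indicator {..a} s \<le> exp (- s) * p (exp (- s))"
    "\<And>s. exp (- s) * p (exp (- s)) \<le> indicator {..b} s"
proof -
  define u v where "u = exp (- b)" and "v = exp (- a)"
  have uv: "0 < u" "u < v" using assms by (auto simp: u_def v_def)
  define p where "p x = max 0 (min 1 ((x - u) / (v - u))) / max x u" for x
  show thesis
  proof
    show "continuous_on UNIV p"
      unfolding p_def using uv by (intro continuous_intros) auto
  next
    fix s :: real
    have A: "s \<le> a \<longleftrightarrow> v \<le> exp (-s)" "s \<le> b \<longleftrightarrow> u \<le> exp (- s)" by (auto simp: u_def v_def)
    show "indicator {..a} s \<le> exp (- s) * p (exp (- s))"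
      using uv by (auto simp: indicator_def A p_def min_def max_def field_simps)
    show "exp (- s) * p (exp (- s)) \<le> indicator {..b} s"
      using uv by (auto simp: indicator_def A p_def min_def max_def divide_simps)
  qed
qed

text \<open>
  The hypothesis says that the finite measures obtained from \<open>exp (- s) m i (ds)\<close> by the
  substitution \<open>x = exp (- s)\<close> have converging moments on \<open>[0, 1]\<close>. Polynomials are uniformly dense
  in the continuous functions there, and the total masses converge (the case \<open>k = 0\<close>), so the
  integrals of all continuous functions converge.
\<close>

lemma integral_exp_weighted_continuous_tendsto:
  fixes m :: "'i \<Rightarrow> real measure" and \<nu> :: "real measure" and p :: "real \<Rightarrow> real"
  assumes sets_m [measurable_cong]: "\<And>i. sets (m i) = sets borel"
    and sets_\<nu> [measurable_cong]: "sets \<nu> = sets borel"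
    and nonneg: "\<And>i. AE s in m i. 0 \<le> s" "AE s in \<nu>. 0 \<le> s"
    and int: "\<forall>\<^sub>F i in F. integrable (m i) (\<lambda>s. exp (- s))" "integrable \<nu> (\<lambda>s. exp (- s))"
    and lim: "\<And>k::nat. ((\<lambda>i. \<integral>s. exp (- (real k + 1) * s) \<partial>m i) \<longlongrightarrow> (\<integral>s. exp (- (real k + 1) * s) \<partial>\<nu>)) F"
    and p: "continuous_on UNIV p"
  shows "((\<lambda>i. \<integral>s. exp (- s) * p (exp (- s)) \<partial>m i) \<longlongrightarrow> (\<integral>s. exp (- s) * p (exp (- s)) \<partial>\<nu>)) F"
proof -
  have int_prod: "integrable N (\<lambda>s. exp (- s) * q (exp (- s)))"
    if N: "sets N = sets borel" "AE s in N. 0 \<le> s" "integrable N (\<lambda>s. exp (- s))"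
      and q: "continuous_on UNIV q" for N :: "real measure" and q :: "real \<Rightarrow> real"
  proof -
    note [measurable_cong] = N(1)
    have [measurable]: "q \<in> borel_measurable borel"
      using q by (rule borel_measurable_continuous_onI)
    have "compact (q ` {0..1})"
      by (intro compact_continuous_image continuous_on_subset[OF q]) auto
    then obtain B where B: "\<And>x. x \<in> {0..1} \<Longrightarrow> \<bar>q x\<bar> \<le> B"
      using compact_imp_bounded bounded_iff by (metis image_eqI real_norm_def)
    show ?thesis
    proof (rule Bochner_Integration.integrable_bound)
      show "integrable N (\<lambda>s. B * exp (- s))" using N(3) by simp
      show "AE s in N. norm (exp (- s) * q (exp (- s))) \<le> norm (B * exp (- s))"
        using N(2)
      proof eventually_elim
        case (elim s)
        then have "\<bar>q (exp (- s))\<bar> \<le> B" by (intro B) auto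
        then show ?case using mult_right_mono[of "\<bar>q (exp (- s))\<bar>" B "exp (- s)"]
          by (simp add: abs_mult mult.commute)
      qed
    qed (measurable)
  qed
  have close: "\<bar>(\<integral>s. exp (- s) * p (exp (- s)) \<partial>N) - (\<integral>s. exp (- s) * q (exp (- s)) \<partial>N)\<bar>
        \<le> e * (\<integral>s. exp (- s) \<partial>N)"
    if N: "sets N = sets borel" "AE s in N. 0 \<le> s" "integrable N (\<lambda>s. exp (- s))"
      and q: "continuous_on UNIV q" and e: "\<And>x. x \<in> {0..1} \<Longrightarrow> \<bar>p x - q x\<bar> < e"
    for N :: "real measure" and q :: "real \<Rightarrow> real" and e
  proof -
    note ip = int_prod[OF N p] and iq = int_prod[OF N q]
    have "\<bar>(\<integral>s. exp (- s) * p (exp (- s)) \<partial>N) - (\<integral>s. exp (- s) * q (exp (- s)) \<partial>N)\<bar>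
      = \<bar>\<integral>s. exp (- s) * p (exp (- s)) - exp (- s) * q (exp (- s)) \<partial>N\<bar>"
      using ip iq by simp
    also have "\<dots> \<le> (\<integral>s. e * exp (- s) \<partial>N)"
    proof (rule integral_abs_bound[THEN order_trans], rule integral_mono_AE)
      show "AE s in N. \<bar>exp (- s) * p (exp (- s)) - exp (- s) * q (exp (- s))\<bar> \<le> e * exp (- s)"
        using N(2)
      proof eventually_elim
        case (elim s)
        have "\<bar>p (exp (-s)) - q (exp (-s))\<bar> \<le> e" using e[of "exp (-s)"] elim by auto
        then show ?case
          using mult_right_mono[of "\<bar>p (exp (-s)) - q (exp (-s))\<bar>" e "exp (-s)"]
          by (simp add: right_diff_distrib[symmetric] abs_mult mult.commute)
      qed
    qed (use ip iq N(3) in auto)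
    finally show ?thesis by simp
  qed
  have poly: "((\<lambda>i. \<integral>s. exp (- s) * q (exp (- s)) \<partial>m i) \<longlongrightarrow> (\<integral>s. exp (- s) * q (exp (- s)) \<partial>\<nu>)) F"
    if poly_q: "real_polynomial_function q" for q :: "real \<Rightarrow> real"
  proof -
    obtain a n where q: "q = (\<lambda>x. \<Sum>i\<le>n. a i * x ^ i)"
      using poly_q unfolding real_polynomial_function_iff_sum by blast
    have expand: "(\<integral>s. exp (- s) * q (exp (- s)) \<partial>N) = (\<Sum>k\<le>n. a k * (\<integral>s. exp (- (real k + 1) * s) \<partial>N))"
      if N: "sets N = sets borel" "AE s in N. 0 \<le> s" "integrable N (\<lambda>s. exp (- s))" for N
    proof -
      have *: "exp (- s) * exp (- s) ^ k = exp (- (real k + 1) * s)" for s and k :: nat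
        by (simp add: exp_of_nat_mult[symmetric] exp_add[symmetric] algebra_simps)
      have "integrable N (\<lambda>s. exp (- s) * (exp (- s)) ^ k)" for k
        using int_prod[OF N, of "\<lambda>x. x ^ k"] by (simp add: continuous_intros)
      then have "integrable N (\<lambda>s. exp (- (real k + 1) * s))" for k :: nat
        unfolding * .
      then have "(\<integral>s. (\<Sum>k\<le>n. a k * exp (- (real k + 1) * s)) \<partial>N)
          = (\<Sum>k\<le>n. a k * (\<integral>s. exp (- (real k + 1) * s) \<partial>N))"
        by (subst Bochner_Integration.integral_sum) (auto simp del: minus_add_distrib)
      moreover have "exp (- s) * q (exp (- s)) = (\<Sum>k\<le>n. a k * exp (- (real k + 1) * s))" for s
        unfolding q sum_distrib_left *[symmetric] by (simp add: algebra_simps)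
      ultimately show ?thesis by simp
    qed
    have "((\<lambda>i. \<Sum>k\<le>n. a k * (\<integral>s. exp (- (real k + 1) * s) \<partial>m i)) \<longlongrightarrow>
        (\<Sum>k\<le>n. a k * (\<integral>s. exp (- (real k + 1) * s) \<partial>\<nu>))) F"
      by (intro tendsto_intros lim)
    then show ?thesis
      unfolding expand[OF sets_\<nu> nonneg(2) int(2)]
      by (rule Lim_transform_eventually)
        (use int(1) in eventually_elim, simp only: expand[OF sets_m nonneg(1)])
  qed
  let ?A = "\<integral>s. exp (- s) \<partial>\<nu>"
  have A0: "?A \<ge> 0" by (rule integral_nonneg_AE) auto
  have mass: "((\<lambda>i. \<integral>s. exp (- s) \<partial>m i) \<longlongrightarrow> ?A) F" using lim[of 0] by simp
  show ?thesis
  proof (rule tendstoI)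
    fix \<epsilon> :: real assume \<epsilon>: "\<epsilon> > 0"
    define e where "e = \<epsilon> / (2 * ?A + 2)"
    have e: "e > 0" unfolding e_def by (rule divide_pos_pos) (use \<epsilon> A0 in linarith)+
    obtain q where q: "real_polynomial_function q" and pq: "\<And>x. x \<in> {0..1} \<Longrightarrow> \<bar>p x - q x\<bar> < e"
      using Stone_Weierstrass_real_polynomial_function[of "{0..1::real}" p e]
        continuous_on_subset[OF p] e by auto
    have cq: "continuous_on UNIV q"
      by (rule continuous_on_polymonial_function) (use q real_polynomial_function_eq in blast)
    let ?D = "\<lambda>i. e * (\<integral>s. exp (- s) \<partial>m i) + \<bar>(\<integral>s. exp (- s) * q (exp (- s)) \<partial>m i) - (\<integral>s. exp (- s) * q (exp (- s)) \<partial>\<nu>)\<bar> + e * ?A"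
    have "(?D \<longlongrightarrow> e * ?A + \<bar>(\<integral>s. exp (- s) * q (exp (- s)) \<partial>\<nu>) - (\<integral>s. exp (- s) * q (exp (- s)) \<partial>\<nu>)\<bar> + e * ?A) F"
      by (intro tendsto_intros mass poly q)
    moreover have "e * ?A + \<bar>(\<integral>s. exp (- s) * q (exp (- s)) \<partial>\<nu>) - (\<integral>s. exp (- s) * q (exp (- s)) \<partial>\<nu>)\<bar> + e * ?A < \<epsilon>"
    proof -
      have "2 * ?A + 2 \<noteq> 0" using A0 by linarith
      then have "e * (2 * ?A + 2) = \<epsilon>" unfolding e_def by simp
      then have "e * ?A + e * ?A + 2 * e = \<epsilon>" by (simp add: distrib_left)
      then show ?thesis using e by linarith
    qed
    ultimately have "\<forall>\<^sub>F i in F. ?D i < \<epsilon>" by (rule order_tendstoD)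
    then show "\<forall>\<^sub>F i in F. dist (\<integral>s. exp (- s) * p (exp (- s)) \<partial>m i) (\<integral>s. exp (- s) * p (exp (- s)) \<partial>\<nu>) < \<epsilon>"
      using int(1)
    proof eventually_elim
      case (elim i)
      then show ?case
        using close[OF sets_m nonneg(1) _ cq pq, of i] close[OF sets_\<nu> nonneg(2) int(2) cq pq]
        unfolding dist_real_def by linarith
    qed
  qed
qed

text \<open>
  The indicator of \<open>{..a}\<close> lies between the weighted cutoffs for \<open>{..b}\<close> with \<open>b\<close> slightly
  below and slightly above \<open>a\<close>; their integrals converge, and continuity of the limiting
  distribution function at \<open>a\<close> closes the gap.
\<close>

lemma measure_atMost_tendsto_of_laplace:
  fixes m :: "'i \<Rightarrow> real measure" and \<nu> :: "real measure"
  assumes sets_m [measurable_cong]: "\<And>i. sets (m i) = sets borel"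
    and sets_\<nu> [measurable_cong]: "sets \<nu> = sets borel"
    and nonneg: "\<And>i. AE s in m i. 0 \<le> s" "AE s in \<nu>. 0 \<le> s"
    and int: "\<forall>\<^sub>F i in F. integrable (m i) (\<lambda>s. exp (- s))" "integrable \<nu> (\<lambda>s. exp (- s))"
    and lim: "\<And>k::nat. ((\<lambda>i. \<integral>s. exp (- (real k + 1) * s) \<partial>m i) \<longlongrightarrow> (\<integral>s. exp (- (real k + 1) * s) \<partial>\<nu>)) F"
    and cont: "isCont (\<lambda>b. measure \<nu> {..b}) a"
  shows "((\<lambda>i. measure (m i) {..a}) \<longlongrightarrow> measure \<nu> {..a}) F"
proof -
  have fin: "emeasure N {..b} < \<infinity>"
    if N: "sets N = sets borel" "integrable N (\<lambda>s. exp (- s))" for N :: "real measure" and b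
  proof -
    note [measurable_cong] = N(1)
    \<comment> \<open>Chebyshev's inequality for \<open>exp (- s)\<close>, which is at least \<open>exp (- b)\<close> on \<open>{..b}\<close>.\<close>
    have "emeasure N {..b} = (\<integral>\<^sup>+s. indicator {..b} s \<partial>N)" by simp
    also have "\<dots> \<le> (\<integral>\<^sup>+s. ennreal (exp b * exp (- s)) \<partial>N)"
      by (intro nn_integral_mono) (auto simp: indicator_def exp_add[symmetric] simp flip: ennreal_1)
    also have "\<dots> < \<infinity>"
      using N(2) by (subst nn_integral_eq_integral) auto
    finally show ?thesis .
  qed
  have bracket: "measure N {..b} \<le> (\<integral>s. exp (- s) * p (exp (- s)) \<partial>N)"
      "(\<integral>s. exp (- s) * p (exp (- s)) \<partial>N) \<le> measure N {..c}"
    if N: "sets N = sets borel" "integrable N (\<lambda>s. exp (- s))"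
      and p: "continuous_on UNIV p" "\<And>s. indicator {..b} s \<le> exp (- s) * p (exp (- s))"
       "\<And>s. exp (- s) * p (exp (- s)) \<le> indicator {..c} s" for N :: "real measure" and p b c
  proof -
    note [measurable_cong] = N(1)
    have [measurable]: "p \<in> borel_measurable borel"
      using p(1) by (rule borel_measurable_continuous_onI)
    have ic: "integrable N (indicator {..c} :: real \<Rightarrow> real)" "integrable N (indicator {..b} :: real \<Rightarrow> real)"
      using fin[OF N] by (auto simp: N(1))
    have "0 \<le> exp (- s) * p (exp (- s))" for s
      by (rule order_trans[OF _ p(2)]) simp
    then have "integrable N (\<lambda>s. exp (- s) * p (exp (- s)))"
      by (intro Bochner_Integration.integrable_bound[OF ic(1)]) (auto simp: p(3))
    then have "(\<integral>s. indicator {..b} s \<partial>N) \<le> (\<integral>s. exp (- s) * p (exp (- s)) \<partial>N)"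
      "(\<integral>s. exp (- s) * p (exp (- s)) \<partial>N) \<le> (\<integral>s. indicator {..c} s \<partial>N)"
      using ic p by (intro integral_mono; simp)+
    then show "measure N {..b} \<le> (\<integral>s. exp (- s) * p (exp (- s)) \<partial>N)"
      "(\<integral>s. exp (- s) * p (exp (- s)) \<partial>N) \<le> measure N {..c}" by (simp_all add: N(1))
  qed
  let ?N = "\<lambda>b. measure \<nu> {..b}"
  note conv = integral_exp_weighted_continuous_tendsto[OF sets_m sets_\<nu> nonneg int lim]
  show ?thesis
  proof (rule order_tendstoI)
    fix y assume y: "y < ?N a"
    have "(?N \<longlongrightarrow> ?N a) (at_left a)"
      using cont by (auto simp: isCont_def filterlim_at_split)
    then have "\<forall>\<^sub>F b in at_left a. y < ?N b" using y by (rule order_tendstoD)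
    then obtain b where b: "b < a" "y < ?N b"
      unfolding eventually_at_left_field by (metis dense)
    obtain p where p: "continuous_on UNIV p"
      "\<And>s. indicator {..b} s \<le> exp (- s) * p (exp (- s))"
      "\<And>s. exp (- s) * p (exp (- s)) \<le> indicator {..a} s"
      using exp_weighted_cutoff[OF b(1)] by blast
    have "y < (\<integral>s. exp (- s) * p (exp (- s)) \<partial>\<nu>)"
      using bracket(1)[OF sets_\<nu> int(2) p] b(2) by simp
    with conv[OF p(1)] have "\<forall>\<^sub>F i in F. y < (\<integral>s. exp (- s) * p (exp (- s)) \<partial>m i)"
      by (rule order_tendstoD)
    then show "\<forall>\<^sub>F i in F. y < measure (m i) {..a}"
      using int(1) by eventually_elim (use bracket(2)[OF sets_m _ p] in fastforce)
  next
    fix y assume y: "?N a < y"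
    have "(?N \<longlongrightarrow> ?N a) (at_right a)"
      using cont by (auto simp: isCont_def filterlim_at_split)
    then have "\<forall>\<^sub>F b in at_right a. ?N b < y" using y by (rule order_tendstoD)
    then obtain b where b: "a < b" "?N b < y"
      unfolding eventually_at_right_field by (metis dense)
    obtain p where p: "continuous_on UNIV p"
      "\<And>s. indicator {..a} s \<le> exp (- s) * p (exp (- s))"
      "\<And>s. exp (- s) * p (exp (- s)) \<le> indicator {..b} s"
      using exp_weighted_cutoff[OF b(1)] by blast
    have "(\<integral>s. exp (- s) * p (exp (- s)) \<partial>\<nu>) < y"
      using bracket(2)[OF sets_\<nu> int(2) p] b(2) by simp
    with conv[OF p(1)] have "\<forall>\<^sub>F i in F. (\<integral>s. exp (- s) * p (exp (- s)) \<partial>m i) < y"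
      by (rule order_tendstoD)
    then show "\<forall>\<^sub>F i in F. measure (m i) {..a} < y"
      using int(1) by eventually_elim (use bracket(1)[OF sets_m _ p] in fastforce)
  qed
qed

lemma nn_integral_powr_exp:
  fixes \<rho> u :: real
  assumes "\<rho> > 0" "u > 0"
  shows "(\<integral>\<^sup>+s. ennreal (indicator {0..} s * s powr (\<rho> - 1) * exp (- (u * s))) \<partial>lborel) = ennreal (u powr (- \<rho>) * Gamma \<rho>)"
proof -
  have "(\<integral>\<^sup>+s. ennreal (indicator {0..} s * s powr (\<rho> - 1) * exp (- (u * s))) \<partial>lborel)
      = ennreal \<bar>1 / u\<bar> * (\<integral>\<^sup>+t. ennreal (indicator {0..} (0 + 1 / u * t) * (0 + 1 / u * t) powr (\<rho> - 1) * exp (- (u * (0 + 1 / u * t)))) \<partial>lborel)"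
    using assms by (intro nn_integral_real_affine) auto
  also have "\<dots> = (\<integral>\<^sup>+t. ennreal (u powr (- \<rho>)) * ennreal (indicator {0..} t * t powr (\<rho> - 1) / exp t) \<partial>lborel)"
    using assms
    by (subst nn_integral_cmult[symmetric])
      (auto intro!: nn_integral_cong simp: indicator_def powr_divide powr_minus powr_diff exp_minus
        field_simps zero_le_divide_iff simp flip: ennreal_mult)
  also have "\<dots> = ennreal (u powr (- \<rho>)) * ennreal (Gamma \<rho>)"
    using assms by (subst nn_integral_cmult) (auto simp: Gamma_conv_nn_integral_real)
  finally show ?thesis using assms by (simp add: ennreal_mult')
qed

text \<open>
  The limit measure in Karamata's theorem: the measure with density \<open>s powr (\<rho> - 1) / Gamma \<rho>\<close>
  on the half-line, which degenerates to a unit mass at the origin when \<open>\<rho> = 0\<close>.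
\<close>

lemma exists_measure_laplace_powr:
  fixes \<rho> :: real
  assumes "0 \<le> \<rho>"
  obtains \<nu> :: "real measure" where "sets \<nu> = sets borel" "AE s in \<nu>. 0 \<le> s"
    "\<And>u. 0 < u \<Longrightarrow> integrable \<nu> (\<lambda>s. exp (- (u * s)))"
    "\<And>u. 0 < u \<Longrightarrow> (\<integral>s. exp (- (u * s)) \<partial>\<nu>) = u powr (- \<rho>)"
    "\<And>b. 0 < b \<Longrightarrow> measure \<nu> {..b} = b powr \<rho> / Gamma (1 + \<rho>)"
proof (cases "\<rho> = 0")
  case True
  show ?thesis
  proof
    interpret prob_space "return borel (0::real)" by (rule prob_space_return) simp
    show "AE s in return borel (0::real). 0 \<le> s" by (simp add: AE_return)
    fix u :: real assume "0 < u"
    show i: "integrable (return borel 0) (\<lambda>s. exp (- (u * s)))"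
      by (rule integrable_cong_AE_imp[of _ "\<lambda>_. 1"]) (auto simp: AE_return)
    show "(\<integral>s. exp (- (u * s)) \<partial>return borel 0) = u powr (- \<rho>)"
      using True \<open>0 < u\<close> by (subst integral_return) auto
  next
    fix b :: real assume "0 < b"
    then show "measure (return borel 0) {..b} = b powr \<rho> / Gamma (1 + \<rho>)"
      using True by (subst measure_return) auto
  qed simp
next
  case False
  with assms have \<rho>: "\<rho> > 0" by simp
  have G: "Gamma \<rho> > 0" using \<rho> by (rule Gamma_real_pos)
  define w where "w s = indicator {0..} s * s powr (\<rho> - 1) / Gamma \<rho>" for s :: real
  have w0: "0 \<le> w s" for s using G by (auto simp: w_def)
  have [measurable]: "w \<in> borel_measurable borel" unfolding w_def by measurable
  define \<nu> where "\<nu> = density lborel (\<lambda>s. ennreal (w s))"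
  have [measurable_cong]: "sets \<nu> = sets borel" by (simp add: \<nu>_def)
  have lap: "(\<integral>\<^sup>+s. ennreal (exp (- (u * s))) \<partial>\<nu>) = ennreal (u powr (- \<rho>))" if "0 < u" for u
  proof -
    have "(\<integral>\<^sup>+s. ennreal (exp (- (u * s))) \<partial>\<nu>) = (\<integral>\<^sup>+s. ennreal (1 / Gamma \<rho>) * ennreal (indicator {0..} s * s powr (\<rho> - 1) * exp (- (u * s))) \<partial>lborel)"
      unfolding \<nu>_def using G
      by (subst nn_integral_density) (auto intro!: nn_integral_cong simp: w_def w0 simp flip: ennreal_mult)
    also have "\<dots> = ennreal (1 / Gamma \<rho>) * ennreal (u powr (- \<rho>) * Gamma \<rho>)"
      using \<rho> that by (subst nn_integral_cmult) (auto simp: nn_integral_powr_exp)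
    also have "\<dots> = ennreal (u powr (- \<rho>))"
      using G by (simp flip: ennreal_mult)
    finally show ?thesis .
  qed
  show ?thesis
  proof
    show "sets \<nu> = sets borel" by fact
    show "AE s in \<nu>. 0 \<le> s"
      unfolding \<nu>_def by (subst AE_density) (auto simp: w_def indicator_def)
    fix u :: real assume u: "0 < u"
    show "integrable \<nu> (\<lambda>s. exp (- (u * s)))"
      by (rule integrableI_nonneg) (auto simp: lap[OF u])
    show "(\<integral>s. exp (- (u * s)) \<partial>\<nu>) = u powr (- \<rho>)"
      by (subst integral_eq_nn_integral) (auto simp: lap[OF u])
  next
    fix b :: real assume b: "0 < b"
    have "emeasure \<nu> {..b} = (\<integral>\<^sup>+s. ennreal (w s) * indicator {..b} s \<partial>lborel)"
      unfolding \<nu>_def by (rule emeasure_density) auto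
    also have "\<dots> = (\<integral>\<^sup>+s. ennreal (1 / Gamma \<rho>) * (ennreal (s powr (\<rho> - 1)) * indicator {0..b} s) \<partial>lborel)"
      using G by (intro nn_integral_cong) (auto simp: w_def indicator_def simp flip: ennreal_mult)
    also have "\<dots> = ennreal (1 / Gamma \<rho>) * ennreal (b powr (\<rho> - 1 + 1) / (\<rho> - 1 + 1))"
      using \<rho> b nn_integral_has_integral_lebesgue'[OF _ has_integral_powr_from_0[of "\<rho> - 1" b]]
      by (subst nn_integral_cmult) auto
    also have "\<dots> = ennreal (b powr \<rho> / Gamma (1 + \<rho>))"
      using \<rho> G Gamma_plus1[of \<rho>] nonpos_Ints_nonpos[of \<rho>] by (force simp add: add.commute mult.commute field_simps simp flip: ennreal_mult)
    finally show "measure \<nu> {..b} = b powr \<rho> / Gamma (1 + \<rho>)"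
      using \<rho> by (simp add: measure_def Gamma_real_pos less_imp_le)
  qed
qed

text \<open>
  Rescale \<open>\<mu>\<close> by \<open>x\<close> in space and by \<open>h x\<close> in mass. By regular variation, the hypothesis on
  the transform of \<open>\<mu>\<close> turns into convergence of the transforms of the rescaled measures: at
  \<open>k + 1\<close> they converge to \<open>c * (k + 1) powr (- \<rho>)\<close>,
  the transform of \<open>c\<close> times the measure from \<open>exists_measure_laplace_powr\<close>; the claim is the
  resulting convergence of the masses of \<open>{..1}\<close>.
\<close>

theorem karamata_tauberian:
  fixes \<mu> :: "real measure" and h :: "real \<Rightarrow> real"
  assumes sets_\<mu> [measurable_cong]: "sets \<mu> = sets borel" and nonneg: "AE s in \<mu>. 0 \<le> s"
    and \<rho>: "0 \<le> \<rho>" and h: "regularly_varying_at_infinity \<rho> h"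
    and int: "\<forall>\<^sub>F x in at_top. integrable \<mu> (\<lambda>s. exp (- (s / x)))"
    and lim: "((\<lambda>x. (\<integral>s. exp (- (s / x)) \<partial>\<mu>) / h x) \<longlongrightarrow> c) at_top"
  shows "((\<lambda>x. measure \<mu> {..x} / h x) \<longlongrightarrow> c / Gamma (1 + \<rho>)) at_top"
proof -
  have h_pos: "\<forall>\<^sub>F x in at_top. 0 < h x"
    using h by (auto simp: regularly_varying_at_infinity_def eventually_at_top_linorder)
  have h_lim: "((\<lambda>x. h (a * x) / h x) \<longlongrightarrow> a powr \<rho>) at_top" if "0 < a" for a
    using h that by (auto simp: regularly_varying_at_infinity_def)
  have x_pos: "\<forall>\<^sub>F x :: real in at_top. 0 < x" by (rule eventually_gt_at_top)
  have c: "0 \<le> c"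
    by (rule tendsto_lowerbound[OF lim])
      (use h_pos in eventually_elim, auto intro!: divide_nonneg_pos integral_nonneg_AE)
  obtain \<nu> :: "real measure" where \<nu> [measurable_cong]: "sets \<nu> = sets borel" and \<nu>_nonneg: "AE s in \<nu>. 0 \<le> s"
    and \<nu>_int: "\<And>u. 0 < u \<Longrightarrow> integrable \<nu> (\<lambda>s. exp (- (u * s)))"
    and \<nu>_lap: "\<And>u. 0 < u \<Longrightarrow> (\<integral>s. exp (- (u * s)) \<partial>\<nu>) = u powr (- \<rho>)"
    and \<nu>_cdf: "\<And>b. 0 < b \<Longrightarrow> measure \<nu> {..b} = b powr \<rho> / Gamma (1 + \<rho>)"
    using exists_measure_laplace_powr[OF \<rho>] by blast
  \<comment> \<open>The absolute values make \<open>m x\<close> a measure on the half-line for every \<open>x\<close>; only large \<open>x\<close> matter.\<close>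
  define m where "m x = density (distr \<mu> borel (\<lambda>s. s / \<bar>x\<bar>)) (\<lambda>_. ennreal \<bar>1 / h x\<bar>)" for x
  define \<nu>' where "\<nu>' = density \<nu> (\<lambda>_. ennreal c)"
  have m_sets [measurable_cong]: "sets (m x) = sets borel" for x by (simp add: m_def)
  have \<nu>'_sets [measurable_cong]: "sets \<nu>' = sets borel" by (simp add: \<nu>'_def \<nu>)
  have m_integral: "(\<integral>s. f s \<partial>m x) = \<bar>1 / h x\<bar> * (\<integral>s. f (s / \<bar>x\<bar>) \<partial>\<mu>)"
    if [measurable]: "f \<in> borel_measurable borel" for f :: "real \<Rightarrow> real" and x
    unfolding m_def by (subst integral_density) (auto simp: integral_distr)
  have \<nu>'_integral: "(\<integral>s. f s \<partial>\<nu>') = c * (\<integral>s. f s \<partial>\<nu>)"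
    if [measurable]: "f \<in> borel_measurable borel" for f :: "real \<Rightarrow> real"
    unfolding \<nu>'_def using c by (subst integral_density) auto
  have m_measure: "measure (m x) {..1} = \<bar>1 / h x\<bar> * measure \<mu> {..x}" if "0 < x" for x
  proof -
    have "measure (m x) {..1} = \<bar>1 / h x\<bar> * (\<integral>s. indicator {..1} (s / \<bar>x\<bar>) \<partial>\<mu>)"
      by (subst m_integral[symmetric]) (auto simp: m_sets)
    also have "(\<lambda>s. indicator {..1} (s / \<bar>x\<bar>) :: real) = indicator {..x}"
      using that by (auto simp: indicator_def fun_eq_iff)
    finally show ?thesis by (simp add: sets_\<mu>)
  qed
  have \<nu>'_measure: "measure \<nu>' {..b} = c * (b powr \<rho> / Gamma (1 + \<rho>))" if "0 < b" for b
  proof -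
    have "measure \<nu>' {..b} = c * (\<integral>s. indicator {..b} s \<partial>\<nu>)"
      by (subst \<nu>'_integral[symmetric]) (auto simp: \<nu>'_sets)
    then show ?thesis using \<nu>_cdf[OF that] by (simp add: \<nu>)
  qed
  have "((\<lambda>x. measure (m x) {..1}) \<longlongrightarrow> measure \<nu>' {..1}) at_top"
  proof (rule measure_atMost_tendsto_of_laplace)
    show "AE s in m x. 0 \<le> s" for x
      unfolding m_def
      by (subst AE_density, simp, subst AE_distr_iff) (use nonneg in auto)
    show "AE s in \<nu>'. 0 \<le> s"
      unfolding \<nu>'_def by (subst AE_density) (use \<nu>_nonneg in auto)
    show "integrable \<nu>' (\<lambda>s. exp (- s))"
      unfolding \<nu>'_def using c \<nu>_int[of 1] by (subst integrable_density) auto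
    show "\<forall>\<^sub>F x in at_top. integrable (m x) (\<lambda>s. exp (- s))"
      using int x_pos
      by eventually_elim (auto simp: m_def integrable_density integrable_distr_eq)
    fix k :: nat
    let ?a = "1 / (real k + 1)"
    have a: "0 < ?a" by simp
    have "filterlim (\<lambda>x. ?a * x) at_top at_top"
      by (rule filterlim_tendsto_pos_mult_at_top[OF tendsto_const a filterlim_ident])
    from filterlim_compose[OF lim this]
    have "((\<lambda>x. (h (?a * x) / h x) * ((\<integral>s. exp (- (s / (?a * x))) \<partial>\<mu>) / h (?a * x))) \<longlongrightarrow> ?a powr \<rho> * c) at_top"
      by (intro tendsto_mult h_lim a)
    moreover have "\<forall>\<^sub>F x in at_top. (h (?a * x) / h x) * ((\<integral>s. exp (- (s / (?a * x))) \<partial>\<mu>) / h (?a * x))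
        = (\<integral>s. exp (- (real k + 1) * s) \<partial>m x)"
      using h_pos x_pos filterlim_iff[THEN iffD1, rule_format, OF \<open>filterlim (\<lambda>x. ?a * x) at_top at_top\<close> h_pos]
    proof eventually_elim
      case (elim x)
      have "(\<integral>s. exp (- (real k + 1) * s) \<partial>m x) = \<bar>1 / h x\<bar> * (\<integral>s. exp (- (real k + 1) * (s / \<bar>x\<bar>)) \<partial>\<mu>)"
        by (subst m_integral) auto
      moreover have "- (real k + 1) * (s / \<bar>x\<bar>) = - (s / (?a * x))" for s
        using elim by (simp add: field_simps)
      ultimately show ?case using elim by simp
    qed
    moreover have "?a powr \<rho> * c = (\<integral>s. exp (- (real k + 1) * s) \<partial>\<nu>')"
    proof -
      have "(\<integral>s. exp (- (real k + 1) * s) \<partial>\<nu>') = c * (\<integral>s. exp (- ((real k + 1) * s)) \<partial>\<nu>)"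
        by (subst \<nu>'_integral) (auto simp only: minus_mult_left, measurable)
      then show ?thesis by (subst (asm) \<nu>_lap) (auto simp: powr_divide powr_minus field_simps)
    qed
    ultimately show "((\<lambda>x. \<integral>s. exp (- (real k + 1) * s) \<partial>m x) \<longlongrightarrow> (\<integral>s. exp (- (real k + 1) * s) \<partial>\<nu>')) at_top"
      using Lim_transform_eventually by fastforce
  next
    have "isCont (\<lambda>b. c * (b powr \<rho> / Gamma (1 + \<rho>))) 1"
      using \<rho> Gamma_real_pos[of "1 + \<rho>"] by (intro continuous_intros) linarith+
    moreover have "\<forall>\<^sub>F b in nhds 1. measure \<nu>' {..b} = c * (b powr \<rho> / Gamma (1 + \<rho>))"
      using \<nu>'_measure by (auto intro!: eventually_nhds_in_open[THEN eventually_mono, of "{0<..}"])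
    ultimately show "isCont (\<lambda>b. measure \<nu>' {..b}) 1"
      by (simp add: isCont_cong)
  qed (fact m_sets \<nu>'_sets)+
  moreover have "\<forall>\<^sub>F x in at_top. measure (m x) {..1} = measure \<mu> {..x} / h x"
    using h_pos x_pos by eventually_elim (simp add: m_measure)
  ultimately show ?thesis
    using \<nu>'_measure[of 1] by (auto elim!: Lim_transform_eventually)
qed

section \<open>The standard Gaussian measure\<close>

definition standard_gaussian :: "'a::euclidean_space measure" where
  "standard_gaussian = density lborel (\<lambda>x. ennreal (\<Prod>b\<in>Basis. std_normal_density (x \<bullet> b)))"

lemma sets_standard_gaussian [measurable_cong, simp]:
  "sets (standard_gaussian :: 'a::euclidean_space measure) = sets borel"
  by (simp add: standard_gaussian_def)

lemma space_standard_gaussian [simp]: "space (standard_gaussian :: 'a::euclidean_space measure) = UNIV"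
  by (simp add: standard_gaussian_def)

lemma prod_std_normal_density:
  "(\<Prod>b\<in>Basis. std_normal_density (x \<bullet> b)) =
     (2 * pi) powr (- (real DIM('a) / 2)) * exp (- ((norm x)\<^sup>2 / 2))" for x :: "'a::euclidean_space"
proof -
  have "(2 * pi) powr (- (real DIM('a) / 2)) = (1 / sqrt (2 * pi)) ^ DIM('a)"
    by (simp add: powr_half_sqrt[symmetric] powr_minus powr_powr powr_realpow[symmetric] power_divide divide_simps)
  moreover have "(norm x)\<^sup>2 = (\<Sum>b\<in>Basis. (x \<bullet> b)\<^sup>2)"
    unfolding power2_norm_eq_inner by (subst euclidean_inner) (simp add: power2_eq_square)
  ultimately show ?thesis
    by (simp add: std_normal_density_def prod.distrib prod_dividef exp_sum[symmetric] power_one_over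
        sum_negf sum_divide_distrib[symmetric])
qed

lemma prob_space_standard_gaussian: "prob_space (standard_gaussian :: 'a::euclidean_space measure)"
proof
  have "(\<integral>\<^sup>+(x::'a). (\<Prod>b\<in>Basis. ennreal (std_normal_density (x \<bullet> b))) \<partial>lborel) = (\<Prod>b\<in>(Basis::'a set). (\<integral>\<^sup>+x. ennreal (std_normal_density x) \<partial>lborel))"
    by (rule nn_integral_lborel_prod) auto
  also have "(\<integral>\<^sup>+x. ennreal (std_normal_density x) \<partial>lborel) = 1"
    using prob_space.emeasure_space_1[OF prob_space_normal_density[of 1 0]]
    by (simp add: emeasure_density)
  finally show "emeasure (standard_gaussian :: 'a measure) (space standard_gaussian) = 1"
    by (simp add: standard_gaussian_def emeasure_density prod_ennreal)
qed

text \<open>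
  The coordinates are independent, so the one-dimensional characteristic functions multiply.
\<close>

lemma standard_gaussian_characteristic_function:
  fixes \<xi> :: "'a::euclidean_space"
  shows "(\<integral>x. cos (\<xi> \<bullet> x) \<partial>standard_gaussian) = exp (- ((norm \<xi>)\<^sup>2 / 2))"
proof -
  let ?f = "\<lambda>b y. std_normal_density y *\<^sub>R iexp ((\<xi> \<bullet> b) * y)"
  interpret product_sigma_finite "\<lambda>_::'a. lborel :: real measure" ..
  interpret prob_space "standard_gaussian :: 'a measure" by (rule prob_space_standard_gaussian)
  have int: "integrable lborel (?f b)" for b :: 'a
    by (rule Bochner_Integration.integrable_bound[OF integrable_normal_density[of 1 0]]) auto
  have ch: "(\<integral>y. ?f b y \<partial>lborel) = complex_of_real (exp (- ((\<xi> \<bullet> b)\<^sup>2 / 2)))" for b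
    using fun_cong[OF char_std_normal_distribution, of "\<xi> \<bullet> b"]
    by (simp add: char_def integral_density)
  have exp_inner: "iexp (\<xi> \<bullet> x) = (\<Prod>b\<in>Basis. iexp ((\<xi> \<bullet> b) * (x \<bullet> b)))" for x :: 'a
    by (subst euclidean_inner) (simp add: exp_sum[symmetric] sum_distrib_left)
  have "(\<integral>x. iexp (\<xi> \<bullet> x) \<partial>standard_gaussian) = (\<integral>x. (\<Prod>b\<in>Basis. ?f b (x \<bullet> b)) \<partial>lborel)"
    unfolding standard_gaussian_def
    by (subst integral_density) (auto simp: exp_inner scaleR_conv_of_real prod.distrib intro!: prod_nonneg)
  also have "\<dots> = (\<integral>x. (\<Prod>b\<in>Basis. ?f b (x b)) \<partial>(\<Pi>\<^sub>M b\<in>(Basis::'a set). lborel))"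
    by (subst lborel_eq, subst integral_distr)
      (auto intro!: Bochner_Integration.integral_cong prod.cong simp: inner_sum_left inner_Basis if_distrib cong: if_cong)
  also have "\<dots> = (\<Prod>b\<in>Basis. \<integral>y. ?f b y \<partial>lborel)"
    by (rule product_integral_prod) (use int in auto)
  also have "\<dots> = of_real (exp (- ((norm \<xi>)\<^sup>2 / 2)))"
  proof -
    have "(norm \<xi>)\<^sup>2 = (\<Sum>b\<in>Basis. (\<xi> \<bullet> b)\<^sup>2)"
      unfolding power2_norm_eq_inner by (subst euclidean_inner) (simp add: power2_eq_square)
    then show ?thesis
      unfolding ch by (simp add: exp_sum[symmetric] sum_negf sum_divide_distrib[symmetric] flip: of_real_prod)
  qed
  finally have *: "(\<integral>x. iexp (\<xi> \<bullet> x) \<partial>standard_gaussian) = of_real (exp (- ((norm \<xi>)\<^sup>2 / 2)))" .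
  have "integrable standard_gaussian (\<lambda>x. iexp (\<xi> \<bullet> x))"
    by (rule integrable_const_bound[where B=1]) auto
  then have "Re (\<integral>x. iexp (\<xi> \<bullet> x) \<partial>standard_gaussian) = (\<integral>x. Re (iexp (\<xi> \<bullet> x)) \<partial>standard_gaussian)"
    by simp
  then show ?thesis
    unfolding * by (simp add: Re_exp)
qed

text \<open>
  Polar integration for radial functions, in the variable \<open>s = |x|\<^sup>2 / 2\<close> in which the Gaussian
  weight becomes \<open>exp (- s)\<close>. Both measures give \<open>{..a}\<close> the volume of the ball of radius
  \<open>sqrt (2 a)\<close>.
\<close>

lemma distr_lborel_half_norm_square:
  "distr lborel borel (\<lambda>x::'a::euclidean_space. (norm x)\<^sup>2 / 2) =
    density lborel (\<lambda>s. ennreal ((2 * pi) powr (real DIM('a) / 2) / Gamma (real DIM('a) / 2))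
       * ennreal (indicator {0..} s * s powr (real DIM('a) / 2 - 1)))"
    (is "?L = density lborel (\<lambda>s. ennreal ?K * _)")
proof (rule measure_eqI_generator_eq[where \<Omega>=UNIV and E="range atMost" and A="\<lambda>n. {..real n}"])
  let ?R = "density lborel (\<lambda>s. ennreal ?K * ennreal (indicator {0..} s * s powr (real DIM('a) / 2 - 1)))"
  have G: "0 < Gamma (real DIM('a) / 2)" by (rule Gamma_real_pos) auto
  have Gamma_succ: "Gamma (real DIM('a) / 2 + 1) = real DIM('a) / 2 * Gamma (real DIM('a) / 2)"
    by (rule Gamma_plus1) (use nonpos_Ints_nonpos[of "real DIM('a) / 2"] in force)
  have L: "emeasure ?L {..a} = ennreal ((2 * pi) powr (real DIM('a) / 2) / Gamma (real DIM('a) / 2 + 1) * (if 0 \<le> a then a powr (real DIM('a) / 2) else 0))" for a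
  proof (cases "0 \<le> a")
    case True
    have "(\<lambda>x::'a. (norm x)\<^sup>2 / 2) -` {..a} = cball 0 (sqrt (2 * a))"
      using True by (auto simp: real_le_rsqrt sqrt_ge_absD dest: sqrt_ge_absD intro!: real_le_rsqrt)
        (metis abs_norm_cancel mult.commute real_sqrt_abs real_sqrt_le_iff)
    then have "emeasure ?L {..a} = emeasure lborel (cball (0::'a) (sqrt (2 * a)))"
      by (subst emeasure_distr) auto
    also have "\<dots> = ennreal (unit_ball_vol (real DIM('a)) * sqrt (2 * a) ^ DIM('a))"
      using True by (intro emeasure_cball) auto
    also have "sqrt (2 * a) ^ DIM('a) = 2 powr (real DIM('a) / 2) * a powr (real DIM('a) / 2)"
    proof (cases "a = 0")
      case False
      then have "sqrt (2 * a) ^ DIM('a) = (2 * a) powr (real DIM('a) / 2)"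
        using True by (subst powr_realpow[symmetric]) (auto simp: powr_half_sqrt[symmetric] powr_powr)
      then show ?thesis using True by (simp add: powr_mult)
    qed auto
    finally show ?thesis using True by (simp add: unit_ball_vol_def powr_mult mult_ac)
  next
    case False
    have *: "\<not> (norm x)\<^sup>2 / 2 \<le> a" for x :: 'a
      using False zero_le_power2[of "norm x"] by linarith
    have "(\<lambda>x::'a. (norm x)\<^sup>2 / 2) -` {..a} = {}"
      using * by auto
    then show ?thesis using False by (subst emeasure_distr) auto
  qed
  have R: "emeasure ?R {..a} = ennreal ((2 * pi) powr (real DIM('a) / 2) / Gamma (real DIM('a) / 2 + 1) * (if 0 \<le> a then a powr (real DIM('a) / 2) else 0))" for a
  proof -
    have "emeasure ?R {..a} = ennreal ?K * (\<integral>\<^sup>+s. ennreal (s powr (real DIM('a) / 2 - 1)) * indicator {0..a} s \<partial>lborel)"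
      by (subst emeasure_density) (auto simp: nn_integral_cmult[symmetric] mult.assoc intro!: nn_integral_cong simp: indicator_def)
    also have "(\<integral>\<^sup>+s. ennreal (s powr (real DIM('a) / 2 - 1)) * indicator {0..a} s \<partial>lborel)
       = ennreal (if 0 \<le> a then a powr (real DIM('a) / 2) / (real DIM('a) / 2) else 0)"
    proof (cases "0 \<le> a")
      case True
      show ?thesis
        using nn_integral_has_integral_lebesgue'[OF _ has_integral_powr_from_0[OF _ True, of "real DIM('a) / 2 - 1"]] True
        by simp
    qed auto
    also have "ennreal ?K * \<dots> = ennreal ((2 * pi) powr (real DIM('a) / 2) / Gamma (real DIM('a) / 2 + 1) * (if 0 \<le> a then a powr (real DIM('a) / 2) else 0))"
      using G by (simp add: Gamma_succ mult_ac flip: ennreal_mult)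
    finally show ?thesis .
  qed
  show "Int_stable (range atMost :: real set set)" by (auto simp: Int_stable_def)
  show "emeasure ?L X = emeasure ?R X" if "X \<in> range atMost" for X
    using that L R by auto
  show "emeasure ?L {..real n} \<noteq> \<infinity>" for n unfolding L by simp
  show "sets ?L = sigma_sets UNIV (range atMost)" "sets ?R = sigma_sets UNIV (range atMost)"
    by (simp_all add: borel_eq_atMost sets_measure_of_conv)
  show "(\<Union>n. {..real n}) = UNIV" using real_arch_simple by auto
qed auto

text \<open>
  Under the Gaussian law \<open>|x|\<^sup>2 / 2\<close> is Gamma distributed with shape \<open>d / 2\<close>.
\<close>

lemma standard_gaussian_negative_moment:
  assumes "b < real DIM('a::euclidean_space) / 2"
  shows "(\<integral>\<^sup>+(x::'a). ennreal (((norm x)\<^sup>2 / 2) powr (- b)) \<partial>standard_gaussian)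
    = ennreal (Gamma (real DIM('a) / 2 - b) / Gamma (real DIM('a) / 2))"
proof -
  let ?d = "real DIM('a) / 2" and ?K = "(2 * pi) powr (real DIM('a) / 2) / Gamma (real DIM('a) / 2)"
  let ?q = "\<lambda>x::'a. (norm x)\<^sup>2 / 2"
  have G: "0 < Gamma ?d" by (rule Gamma_real_pos) auto
  then have K: "0 \<le> ?K" by (intro divide_nonneg_pos) auto
  have "(\<integral>\<^sup>+x. ennreal (?q x powr (- b)) \<partial>(standard_gaussian :: 'a measure))
     = (\<integral>\<^sup>+x. ennreal ((2 * pi) powr (- ?d) * exp (- ?q x)) * ennreal (?q x powr (- b)) \<partial>lborel)"
    unfolding standard_gaussian_def prod_std_normal_density by (subst nn_integral_density) auto
  also have "\<dots> = (\<integral>\<^sup>+s. ennreal ((2 * pi) powr (- ?d) * exp (- s)) * ennreal (s powr (- b)) \<partial>distr lborel borel ?q)"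
    by (subst nn_integral_distr) auto
  also have "\<dots> = (\<integral>\<^sup>+s. ennreal ((2 * pi) powr (- ?d) * ?K) * ennreal (indicator {0..} s * s powr (?d - b - 1) / exp s) \<partial>lborel)"
  proof -
    have pw: "s powr (?d - b - 1) = s powr (?d - 1) * s powr (- b)" for s :: real
      by (subst powr_add[symmetric]) (simp add: algebra_simps)
    let ?w = "\<lambda>s::real. indicator {0..} s * s powr (?d - 1)"
    have pointwise: "ennreal ?K * ennreal (?w s) * (ennreal ((2 * pi) powr (- ?d) * exp (- s)) * ennreal (s powr (- b)))
      = ennreal ((2 * pi) powr (- ?d) * ?K) * ennreal (indicator {0..} s * s powr (?d - b - 1) / exp s)" (is "?l = ?r") for s
    proof -
      have "?l = ennreal (?K * ?w s * ((2 * pi) powr (- ?d) * exp (- s) * s powr (- b)))"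
        using K by (simp only: ennreal_mult[symmetric] mult_nonneg_nonneg powr_ge_zero exp_ge_zero indicator_pos_le)
      also have "?K * ?w s * ((2 * pi) powr (- ?d) * exp (- s) * s powr (- b))
          = ((2 * pi) powr (- ?d) * ?K) * (indicator {0..} s * (s powr (?d - 1) * s powr (- b)) / exp s)"
        by (simp only: exp_minus divide_inverse mult_ac)
      also have "ennreal \<dots> = ?r"
        unfolding pw using K by (intro ennreal_mult mult_nonneg_nonneg divide_nonneg_nonneg) auto
      finally show ?thesis .
    qed
    show ?thesis
      unfolding distr_lborel_half_norm_square
      by (subst nn_integral_density) (auto simp only: pointwise, measurable)
  qed
  also have "\<dots> = ennreal ((2 * pi) powr (- ?d) * ?K) * ennreal (Gamma (?d - b))"
    using assms by (subst nn_integral_cmult) (auto simp: Gamma_conv_nn_integral_real)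
  also have "\<dots> = ennreal (Gamma (?d - b) / Gamma ?d)"
    using G assms by (simp add: powr_minus Gamma_real_pos less_imp_le flip: ennreal_mult)
  finally show ?thesis .
qed

section \<open>Unimodal laws and the growth of the exponent\<close>

lemma one_minus_cos_le: "1 - cos y \<le> 2 * min 1 (y\<^sup>2)" for y :: real
proof -
  have "1 - cos y = 2 * (sin (y / 2))\<^sup>2" using cos_double_sin[of "y / 2"] by simp
  also have "(sin (y / 2))\<^sup>2 \<le> min 1 (y\<^sup>2)"
  proof -
    have "\<bar>sin (y / 2)\<bar> \<le> \<bar>y\<bar>"
      using abs_sin_x_le_abs_x[of "y / 2"] by linarith
    then have "(sin (y / 2))\<^sup>2 \<le> y\<^sup>2" by (simp add: abs_le_square_iff)
    then show ?thesis by (simp add: sin_squared_eq)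
  qed
  finally show ?thesis by simp
qed

lemma one_minus_cos_ge:
  fixes y :: real assumes "\<bar>y\<bar> \<le> 3"
  shows "y\<^sup>2 / 8 \<le> 1 - cos y"
proof -
  obtain t where "cos y = (\<Sum>m<4. cos_coeff m * y ^ m) + (cos (t + 1/2 * real 4 * pi) / fact 4) * y ^ 4"
    using Maclaurin_cos_expansion[of y 4] by auto
  then have "cos y = 1 - y\<^sup>2 / 2 + cos (t + 2 * pi) / 24 * y ^ 4"
    by (simp add: lessThan_nat_numeral lessThan_Suc cos_coeff_def numeral_3_eq_3[symmetric] fact_numeral)
  also have "\<dots> \<le> 1 - y\<^sup>2 / 2 + 1 / 24 * y ^ 4"
    by (intro add_left_mono mult_right_mono divide_right_mono cos_le_one) auto
  also have "y ^ 4 \<le> 9 * y\<^sup>2"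
  proof -
    have "y\<^sup>2 \<le> 3\<^sup>2" using assms by (intro abs_le_square_iff[THEN iffD1]) auto
    then have "y\<^sup>2 * y\<^sup>2 \<le> 9 * y\<^sup>2" by (intro mult_right_mono) auto
    then show ?thesis by (simp add: power2_eq_square power4_eq_xxxx)
  qed
  finally show ?thesis by simp
qed

text \<open>
  The function \<open>1 - cos\<close> vanishes at all multiples of \<open>2 * pi\<close>, but averaging over
  the dilation \<open>a\<close> leaves only the zero at the origin: for \<open>\<bar>y\<bar> \<le> 3\<close> the integrand is bounded below by
  Taylor expansion, and for larger \<open>\<bar>y\<bar>\<close> the oscillating part \<open>(sin y - sin (y / 2)) / y\<close> of the
  integral is at most \<open>1 / 3\<close>, which is less than the length \<open>1 / 2\<close> of the window.
\<close>

lemma average_one_minus_cos_ge: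
  fixes y :: real
  shows "ennreal (min 1 (y\<^sup>2) / 64) \<le> (\<integral>\<^sup>+a. ennreal (1 - cos (a * y)) * indicator {1/2..1} a \<partial>lborel)"
proof (cases "\<bar>y\<bar> \<le> 3")
  case True
  have "ennreal (min 1 (y\<^sup>2) / 64) \<le> ennreal (y\<^sup>2 / 32) * emeasure lborel {1/2..1::real}"
    by (subst emeasure_lborel_Icc, simp, subst ennreal_mult[symmetric]) (auto intro!: ennreal_leI)
  also have "\<dots> = (\<integral>\<^sup>+a. ennreal (y\<^sup>2 / 32) * indicator {1/2..1::real} a \<partial>lborel)"
    by (simp add: nn_integral_cmult_indicator)
  also have "\<dots> \<le> (\<integral>\<^sup>+a. ennreal (1 - cos (a * y)) * indicator {1/2..1} a \<partial>lborel)"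
  proof (rule nn_integral_mono)
    fix a :: real
    have "ennreal (y\<^sup>2 / 32) \<le> ennreal (1 - cos (a * y))" if a: "a \<in> {1/2..1}"
    proof -
    have "\<bar>a * y\<bar> \<le> 1 * 3" unfolding abs_mult using a True by (intro mult_mono) auto
    then have "(a * y)\<^sup>2 / 8 \<le> 1 - cos (a * y)" by (intro one_minus_cos_ge) simp
    moreover have "(1/2)\<^sup>2 * y\<^sup>2 \<le> (a * y)\<^sup>2"
      unfolding power_mult_distrib using a by (intro mult_right_mono power_mono) auto
    ultimately show ?thesis
      by (intro ennreal_leI) (simp add: power2_eq_square)
    qed
    then show "ennreal (y\<^sup>2 / 32) * indicator {1/2..1} a \<le> ennreal (1 - cos (a * y)) * indicator {1/2..1} a"
      by (auto simp: indicator_def)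
  qed
  finally show ?thesis .
next
  case False
  let ?F = "\<lambda>a. a - sin (a * y) / y"
  have y: "\<bar>y\<bar> > 3" using False by simp
  have "(\<integral>\<^sup>+a. ennreal (1 - cos (a * y)) * indicator {1/2..1} a \<partial>lborel) = ennreal (?F 1 - ?F (1/2))"
    by (rule nn_integral_FTC_Icc) (use y in \<open>auto intro!: derivative_eq_intros\<close>)
  moreover have "min 1 (y\<^sup>2) / 64 \<le> ?F 1 - ?F (1/2)"
  proof -
    have *: "(sin z - sin (z / 2)) / z \<le> 1 / 3" if z: "z > 3" for z :: real
    proof (cases "z \<le> 2 * pi")
      case True
      \<comment> \<open>Here \<open>3 * z / 4\<close> lies between \<open>pi / 2\<close> and \<open>3 * pi / 2\<close>, where the cosine is nonpositive.\<close>
      have "sin (z / 4) \<ge> 0" using z True by (intro sin_ge_zero) auto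
      moreover have "cos (3 * z / 4) \<le> 0"
      proof -
        have "0 \<le> sin (3 * z / 4 - pi / 2)"
          using z True pi_less_4 by (intro sin_ge_zero) auto
        then show ?thesis by (simp add: sin_diff)
      qed
      moreover have "sin z - sin (z / 2) = 2 * sin (z / 4) * cos (3 * z / 4)"
        using sin_diff_sin[of z "z / 2"] by simp
      ultimately have "sin z - sin (z / 2) \<le> 0" by (simp add: mult_nonneg_nonpos)
      then show ?thesis using z by (simp add: divide_nonpos_pos order_trans[of _ 0])
    next
      case False
      then have "z > 6" using pi_gt3 by linarith
      moreover have "sin z - sin (z / 2) \<le> 2" using sin_le_one[of z] sin_ge_minus_one[of "z / 2"] by linarith
      ultimately show ?thesis by (simp add: divide_simps)
    qed
    have "(sin y - sin (y / 2)) / y = (sin \<bar>y\<bar> - sin (\<bar>y\<bar> / 2)) / \<bar>y\<bar>"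
      by (cases "0 \<le> y") (auto simp: abs_if field_simps)
    with *[OF y] have "(sin y - sin (y / 2)) / y \<le> 1 / 3" by simp
    then have "1 / 6 \<le> ?F 1 - ?F (1/2)" by (simp add: diff_divide_distrib)
    moreover have "min 1 (y\<^sup>2) / 64 \<le> 1 / 6" by (auto simp: min_def)
    ultimately show ?thesis by linarith
  qed
  ultimately show ?thesis by (simp add: ennreal_leI)
qed

text \<open>
  Test functions vanishing at the origin do not see the possible atom there, so only the
  density matters.
\<close>

lemma isotropic_unimodal_density:
  fixes \<mu> :: "'a::euclidean_space measure"
  assumes "isotropic_unimodal \<mu>"
  obtains g :: "real \<Rightarrow> real" where "g \<in> borel_measurable borel" "\<And>r. 0 \<le> g r" "antimono_on {0<..} g"
    "\<And>f. f \<in> borel_measurable borel \<Longrightarrow> f 0 = 0 \<Longrightarrow>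
       (\<integral>\<^sup>+x. f x \<partial>\<mu>) = (\<integral>\<^sup>+x. f x * ennreal (g (norm x)) \<partial>lborel)"
proof -
  obtain g0 :: "real \<Rightarrow> real" where sets_\<mu> [measurable_cong]: "sets \<mu> = sets borel"
    and g0: "\<forall>r>0. 0 \<le> g0 r" "antimono_on {0<..} g0"
    and em: "\<And>A. A \<in> sets borel \<Longrightarrow> 0 \<notin> A \<Longrightarrow>
           emeasure \<mu> A = (\<integral>\<^sup>+x\<in>A. ennreal (g0 (norm x)) \<partial>lborel)"
    using assms unfolding isotropic_unimodal_def by blast
  define g where "g r = indicator {0<..} r *\<^sub>R g0 r" for r
  have "mono_on {0<..} (\<lambda>r. - g0 r)"
    using g0(2) by (auto simp: monotone_on_def)
  then have "(\<lambda>r. - g0 r) \<in> borel_measurable (restrict_space borel {0<..})"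
    by (rule borel_measurable_mono_on_fnc)
  then have "g0 \<in> borel_measurable (restrict_space borel {0<..})"
    unfolding borel_measurable_uminus_eq .
  then have g_meas [measurable]: "g \<in> borel_measurable borel"
    unfolding g_def by (subst (asm) borel_measurable_restrict_space_iff) auto
  have g_nonneg: "0 \<le> g r" for r using g0(1) by (auto simp: g_def indicator_def)
  \<comment> \<open>Off the origin \<open>\<mu>\<close> has density \<open>g (norm x)\<close>.\<close>
  have eq: "density \<mu> (indicator (-{0})) = density lborel (\<lambda>x. ennreal (g (norm x)))"
  proof (rule measure_eqI)
    fix A assume "A \<in> sets (density \<mu> (indicator (-{0})))"
    then have [measurable]: "A \<in> sets borel" by (simp add: sets_\<mu>)
    have "emeasure (density \<mu> (indicator (-{0}))) A = (\<integral>\<^sup>+x. indicator (-{0}) x * indicator A x \<partial>\<mu>)"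
      by (rule emeasure_density) auto
    also have "\<dots> = (\<integral>\<^sup>+x. indicator (A - {0}) x \<partial>\<mu>)"
      by (intro nn_integral_cong) (auto simp: indicator_def)
    also have "\<dots> = emeasure \<mu> (A - {0})" by simp
    also have "\<dots> = (\<integral>\<^sup>+x\<in>A - {0}. ennreal (g0 (norm x)) \<partial>lborel)" by (rule em) auto
    also have "\<dots> = (\<integral>\<^sup>+x\<in>A. ennreal (g (norm x)) \<partial>lborel)"
      by (intro nn_integral_cong) (auto simp: indicator_def g_def)
    also have "\<dots> = emeasure (density lborel (\<lambda>x. ennreal (g (norm x)))) A"
      by (rule emeasure_density[symmetric]) auto
    finally show "emeasure (density \<mu> (indicator (-{0}))) A = emeasure (density lborel (\<lambda>x. ennreal (g (norm x)))) A" .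
  qed (simp add: sets_\<mu>)
  show thesis
  proof
    fix f :: "'a \<Rightarrow> ennreal" assume [measurable]: "f \<in> borel_measurable borel" and f0: "f 0 = 0"
    have "(\<integral>\<^sup>+x. f x \<partial>\<mu>) = (\<integral>\<^sup>+x. indicator (-{0}) x * f x \<partial>\<mu>)"
      using f0 by (intro nn_integral_cong) (auto simp: indicator_def)
    also have "\<dots> = (\<integral>\<^sup>+x. f x \<partial>density \<mu> (indicator (-{0})))"
      by (rule nn_integral_density[symmetric]) auto
    also have "\<dots> = (\<integral>\<^sup>+x. ennreal (g (norm x)) * f x \<partial>lborel)"
      unfolding eq by (rule nn_integral_density) auto
    finally show "(\<integral>\<^sup>+x. f x \<partial>\<mu>) = (\<integral>\<^sup>+x. f x * ennreal (g (norm x)) \<partial>lborel)"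
      by (simp add: mult.commute)
  qed (fact g_meas, fact g_nonneg, use g0(2) in \<open>auto simp: g_def monotone_on_def\<close>)
qed

text \<open>
  This is where unimodality enters. A radially decreasing density satisfies \<open>g |x| \<ge> g (|x| / a)\<close> for
  \<open>a \<le> 1\<close>, so replacing \<open>1 - cos (\<xi> \<bullet> x)\<close> by its dilate \<open>1 - cos (a (\<xi> \<bullet> x))\<close> increases the integral by
  a factor of at most \<open>a powr (- d)\<close>. Averaging over \<open>a \<in> [1/2, 1]\<close> and applying
  \<open>average_one_minus_cos_ge\<close> removes the zeros of \<open>1 - cos\<close>.
\<close>

lemma isotropic_unimodal_integral_one_minus_cos_ge:
  fixes \<mu> :: "'a::euclidean_space measure" and \<xi> :: 'a
  assumes "isotropic_unimodal \<mu>"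
  shows "(\<integral>\<^sup>+x. ennreal (min 1 ((\<xi> \<bullet> x)\<^sup>2)) \<partial>\<mu>) \<le> ennreal (32 * 2 ^ DIM('a)) * (\<integral>\<^sup>+x. ennreal (1 - cos (\<xi> \<bullet> x)) \<partial>\<mu>)"
proof -
  obtain g where [measurable]: "g \<in> borel_measurable borel" and g_nonneg: "\<And>r. 0 \<le> g r"
    and g_anti: "antimono_on {0<..} g"
    and g: "\<And>f. f \<in> borel_measurable borel \<Longrightarrow> f 0 = 0 \<Longrightarrow>
       (\<integral>\<^sup>+x. f x \<partial>\<mu>) = (\<integral>\<^sup>+x. f x * ennreal (g (norm x)) \<partial>lborel)"
    using isotropic_unimodal_density[OF assms] by blast
  define I where "I = (\<integral>\<^sup>+x. ennreal (1 - cos (\<xi> \<bullet> x)) \<partial>\<mu>)"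
  have I: "I = (\<integral>\<^sup>+x. ennreal (1 - cos (\<xi> \<bullet> x)) * ennreal (g (norm x)) \<partial>lborel)"
    unfolding I_def by (rule g) auto
  have contract: "(\<integral>\<^sup>+x. ennreal (1 - cos (a * (\<xi> \<bullet> x))) * ennreal (g (norm x)) \<partial>lborel) \<le> 2 ^ DIM('a) * I"
    if a: "1/2 \<le> a" "a \<le> 1" for a
  proof -
    have g_le: "g (norm x / a) \<le> g (norm x)" if "x \<noteq> 0" for x :: 'a
      using a that by (intro monotone_onD[OF g_anti]) (auto simp: field_simps mult_left_le)
    have "I \<ge> (\<integral>\<^sup>+x. ennreal (1 - cos (\<xi> \<bullet> x)) * ennreal (g (norm x / a)) \<partial>lborel)"
      unfolding I
    proof (rule nn_integral_mono)
      fix x :: 'a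
      show "ennreal (1 - cos (\<xi> \<bullet> x)) * ennreal (g (norm x / a)) \<le> ennreal (1 - cos (\<xi> \<bullet> x)) * ennreal (g (norm x))"
        using g_le by (cases "x = 0") (auto intro!: mult_left_mono ennreal_leI)
    qed
    also have "(\<integral>\<^sup>+x. ennreal (1 - cos (\<xi> \<bullet> x)) * ennreal (g (norm x / a)) \<partial>lborel)
        = ennreal (a ^ DIM('a)) * (\<integral>\<^sup>+x. ennreal (1 - cos (a * (\<xi> \<bullet> x))) * ennreal (g (norm x)) \<partial>lborel)"
      using a by (subst lborel_affine[of a 0]) (auto simp: nn_integral_density nn_integral_distr nn_integral_cmult)
    finally have *: "ennreal (a ^ DIM('a)) * (\<integral>\<^sup>+x. ennreal (1 - cos (a * (\<xi> \<bullet> x))) * ennreal (g (norm x)) \<partial>lborel) \<le> I" .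
    have "1 \<le> (2 * a) ^ DIM('a)" using a by (intro one_le_power) auto
    then have "1 \<le> ennreal (2 ^ DIM('a)) * ennreal (a ^ DIM('a))"
      using a by (simp add: power_mult_distrib flip: ennreal_mult)
    then have "1 * (\<integral>\<^sup>+x. ennreal (1 - cos (a * (\<xi> \<bullet> x))) * ennreal (g (norm x)) \<partial>lborel)
       \<le> ennreal (2 ^ DIM('a)) * ennreal (a ^ DIM('a)) * (\<integral>\<^sup>+x. ennreal (1 - cos (a * (\<xi> \<bullet> x))) * ennreal (g (norm x)) \<partial>lborel)"
      by (intro mult_right_mono) auto
    also have "\<dots> \<le> ennreal (2 ^ DIM('a)) * I"
      unfolding mult.assoc by (intro mult_left_mono *) auto
    finally show ?thesis by (simp add: ennreal_power[symmetric])
  qed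
  have "ennreal (1 / 64) * (\<integral>\<^sup>+x. ennreal (min 1 ((\<xi> \<bullet> x)\<^sup>2)) \<partial>\<mu>)
    = (\<integral>\<^sup>+x. ennreal (min 1 ((\<xi> \<bullet> x)\<^sup>2) / 64) * ennreal (g (norm x)) \<partial>lborel)"
    by (subst g) (auto simp: nn_integral_cmult[symmetric] mult.assoc[symmetric] ennreal_mult[symmetric] intro!: nn_integral_cong)
  also have "\<dots> \<le> (\<integral>\<^sup>+x. (\<integral>\<^sup>+a. ennreal (1 - cos (a * (\<xi> \<bullet> x))) * indicator {1/2..1} a \<partial>lborel) * ennreal (g (norm x)) \<partial>lborel)"
    by (intro nn_integral_mono mult_right_mono average_one_minus_cos_ge) auto
  also have "\<dots> = (\<integral>\<^sup>+x. (\<integral>\<^sup>+a. ennreal (1 - cos (a * (\<xi> \<bullet> x))) * indicator {1/2..1} a * ennreal (g (norm x)) \<partial>lborel) \<partial>lborel)"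
    by (intro nn_integral_cong nn_integral_multc[symmetric]) auto
  also have "\<dots> = (\<integral>\<^sup>+a. (\<integral>\<^sup>+x. ennreal (1 - cos (a * (\<xi> \<bullet> x))) * indicator {1/2..1} a * ennreal (g (norm x)) \<partial>lborel) \<partial>lborel)"
    by (rule lborel_pair.Fubini') auto
  also have "\<dots> \<le> (\<integral>\<^sup>+a. (2 ^ DIM('a) * I) * indicator {1/2..1::real} a \<partial>lborel)"
    by (intro nn_integral_mono) (use contract in \<open>auto simp: indicator_def\<close>)
  also have "\<dots> = ennreal (1 / 2) * (2 ^ DIM('a) * I)"
    by (subst nn_integral_cmult_indicator) (auto simp: mult.commute)
  finally have le: "ennreal (1 / 64) * (\<integral>\<^sup>+x. ennreal (min 1 ((\<xi> \<bullet> x)\<^sup>2)) \<partial>\<mu>) \<le> ennreal (1 / 2) * (2 ^ DIM('a) * I)" .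
  have "ennreal 64 * (ennreal (1 / 64) * (\<integral>\<^sup>+x. ennreal (min 1 ((\<xi> \<bullet> x)\<^sup>2)) \<partial>\<mu>)) \<le> ennreal 64 * (ennreal (1 / 2) * (2 ^ DIM('a) * I))"
    by (intro mult_left_mono le) auto
  moreover have "ennreal 64 * (ennreal (1 / 64) * z) = z" "ennreal 64 * (ennreal (1 / 2) * (2 ^ DIM('a) * z)) = ennreal (32 * 2 ^ DIM('a)) * z" for z
    unfolding mult.assoc[symmetric]
    by (simp_all only: ennreal_mult[symmetric] ennreal_numeral[symmetric] ennreal_power zero_le_numeral zero_le_power zero_le_divide_1_iff mult_nonneg_nonneg) auto
  ultimately show ?thesis unfolding I_def by simp
qed

lemma levy_process_prob_space_distr:
  assumes "levy_process M X" "0 \<le> t"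
  shows "prob_space (distr M borel (X t))"
  using assms unfolding levy_process_def by (auto intro: prob_space.prob_space_distr)

lemma levy_khintchine_exponent_cos:
  fixes X :: "real \<Rightarrow> 'w \<Rightarrow> 'a::euclidean_space"
  assumes "levy_process M X" "levy_khintchine_exponent M X \<psi>" "0 \<le> t"
  shows "(\<integral>x. cos (\<xi> \<bullet> x) \<partial>distr M borel (X t)) = exp (- (t * \<psi> \<xi>))"
proof -
  interpret prob_space "distr M borel (X t)"
    using assms(1,3) by (rule levy_process_prob_space_distr)
  have "integrable (distr M borel (X t)) (\<lambda>x. iexp (\<xi> \<bullet> x))"
    by (rule integrable_const_bound[where B=1]) auto
  then have "(\<integral>x. Re (iexp (\<xi> \<bullet> x)) \<partial>distr M borel (X t)) = Re (CLINT x|distr M borel (X t). iexp (\<xi> \<bullet> x))"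
    by simp
  also have "\<dots> = Re (exp (- of_real (t * \<psi> \<xi>)))"
    using assms(2,3) unfolding levy_khintchine_exponent_def by simp
  finally show ?thesis by (simp add: Re_exp)
qed

lemma levy_khintchine_exponent_nonneg:
  fixes X :: "real \<Rightarrow> 'w \<Rightarrow> 'a::euclidean_space"
  assumes "levy_process M X" "levy_khintchine_exponent M X \<psi>"
  shows "0 \<le> \<psi> \<xi>"
proof -
  interpret prob_space "distr M borel (X 1)"
    using assms(1) by (rule levy_process_prob_space_distr) simp
  have "(\<integral>x. cos (\<xi> \<bullet> x) \<partial>distr M borel (X 1)) \<le> 1"
    by (rule integral_le_const) (auto intro!: integrable_const_bound[where B=1])
  then show ?thesis
    unfolding levy_khintchine_exponent_cos[OF assms zero_le_one] by simp
qed

lemma levy_khintchine_exponent_measurable: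
  fixes X :: "real \<Rightarrow> 'w \<Rightarrow> 'a::euclidean_space"
  assumes "levy_process M X" "levy_khintchine_exponent M X \<psi>"
  shows "\<psi> \<in> borel_measurable borel"
proof -
  interpret prob_space "distr M borel (X 1)"
    using assms(1) by (rule levy_process_prob_space_distr) simp
  have "(\<lambda>\<xi>. - ln (\<integral>x. cos (\<xi> \<bullet> x) \<partial>distr M borel (X 1))) \<in> borel_measurable borel"
    by (intro borel_measurable_uminus borel_measurable_ln borel_measurable_lebesgue_integral) measurable
  then show ?thesis
    unfolding levy_khintchine_exponent_cos[OF assms zero_le_one] by simp
qed

lemma levy_khintchine_exponent_radial:
  fixes X :: "real \<Rightarrow> 'w \<Rightarrow> real ^ 'n"
  assumes "isotropic_levy_process M X" "levy_khintchine_exponent M X \<psi>" "norm \<xi> = norm \<eta>"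
  shows "\<psi> \<xi> = \<psi> \<eta>"
proof -
  have lp: "levy_process M X" and rot: "rotation_invariant (distr M borel (X 1))"
    using assms(1) unfolding isotropic_levy_process_def by auto
  obtain T where T: "orthogonal_transformation T" "T \<xi> = \<eta>"
    using orthogonal_transformation_exists[OF assms(3)] by blast
  have lin: "linear T" and inner: "\<And>v w. T v \<bullet> T w = v \<bullet> w"
    using T(1) unfolding orthogonal_transformation_def by auto
  have [measurable]: "T \<in> borel_measurable borel"
    using lin by (intro borel_measurable_continuous_onI linear_continuous_on linear_conv_bounded_linear[THEN iffD1])
  have "(\<integral>x. cos (\<eta> \<bullet> x) \<partial>distr M borel (X 1)) = (\<integral>x. cos (\<eta> \<bullet> x) \<partial>distr (distr M borel (X 1)) borel T)"
    using rot T(1) unfolding rotation_invariant_def by simp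
  also have "\<dots> = (\<integral>x. cos (\<eta> \<bullet> T x) \<partial>distr M borel (X 1))"
    by (rule integral_distr) auto
  also have "\<dots> = (\<integral>x. cos (\<xi> \<bullet> x) \<partial>distr M borel (X 1))"
    unfolding T(2)[symmetric] inner ..
  finally show ?thesis
    unfolding levy_khintchine_exponent_cos[OF lp assms(2) zero_le_one] by simp
qed

lemma levy_khintchine_exponent_eq_radial_profile:
  fixes X :: "real \<Rightarrow> 'w \<Rightarrow> real ^ 'n"
  assumes "isotropic_levy_process M X" "levy_khintchine_exponent M X \<psi>"
  shows "\<psi> \<xi> = radial_profile \<psi> (norm \<xi>)"
proof -
  have "norm (SOME e :: real ^ 'n. norm e = 1) = 1"
    by (rule someI[of "\<lambda>e. norm e = 1" "axis undefined 1"]) simp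
  then show ?thesis
    unfolding radial_profile_def by (intro levy_khintchine_exponent_radial[OF assms]) simp
qed

text \<open>
  Sandwich \<open>1 - cos\<close> between multiples of \<open>min 1 y\<^sup>2\<close>, for which
  \<open>min 1 y\<^sup>2 \<le> max 1 (1 / u\<^sup>2) * min 1 ((u y)\<^sup>2)\<close> holds pointwise.
\<close>

lemma isotropic_unimodal_one_minus_cos_almost_increasing:
  fixes \<mu> :: "'a::euclidean_space measure" and \<xi> :: 'a
  assumes \<mu>: "isotropic_unimodal \<mu>" "prob_space \<mu>" and u: "0 < u"
  shows "1 - (\<integral>x. cos (\<xi> \<bullet> x) \<partial>\<mu>) \<le> 64 * 2 ^ DIM('a) * max 1 (1 / u\<^sup>2) * (1 - (\<integral>x. cos ((u *\<^sub>R \<xi>) \<bullet> x) \<partial>\<mu>))"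
proof -
  interpret prob_space \<mu> by fact
  have [measurable_cong]: "sets \<mu> = sets borel" using \<mu>(1) by (simp add: isotropic_unimodal_def)
  have nn: "(\<integral>\<^sup>+x. ennreal (1 - cos (\<eta> \<bullet> x)) \<partial>\<mu>) = ennreal (1 - (\<integral>x. cos (\<eta> \<bullet> x) \<partial>\<mu>))" for \<eta>
  proof -
    have i: "integrable \<mu> (\<lambda>x. cos (\<eta> \<bullet> x))" by (rule integrable_const_bound[where B=1]) auto
    then have "(\<integral>\<^sup>+x. ennreal (1 - cos (\<eta> \<bullet> x)) \<partial>\<mu>) = ennreal (\<integral>x. 1 - cos (\<eta> \<bullet> x) \<partial>\<mu>)"
      by (intro nn_integral_eq_integral) auto
    also have "(\<integral>x. 1 - cos (\<eta> \<bullet> x) \<partial>\<mu>) = 1 - (\<integral>x. cos (\<eta> \<bullet> x) \<partial>\<mu>)"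
      using i by (simp add: prob_space)
    finally show ?thesis .
  qed
  let ?m = "max 1 (1 / u\<^sup>2)"
  have m: "1 \<le> ?m" "1 \<le> ?m * u\<^sup>2" using u by (auto simp: max_def field_simps)
  have trunc: "1 - cos (\<xi> \<bullet> x) \<le> 2 * ?m * min 1 (((u *\<^sub>R \<xi>) \<bullet> x)\<^sup>2)" for x
  proof -
    have "min 1 ((\<xi> \<bullet> x)\<^sup>2) \<le> ?m * 1" using m by linarith
    moreover have "1 * (\<xi> \<bullet> x)\<^sup>2 \<le> ?m * u\<^sup>2 * (\<xi> \<bullet> x)\<^sup>2" by (rule mult_right_mono) (use m in auto)
    ultimately have "min 1 ((\<xi> \<bullet> x)\<^sup>2) \<le> ?m * min 1 (((u *\<^sub>R \<xi>) \<bullet> x)\<^sup>2)"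
      by (auto simp: min_def power_mult_distrib mult.assoc)
    with one_minus_cos_le[of "\<xi> \<bullet> x"] show ?thesis by simp
  qed
  have "ennreal (1 - (\<integral>x. cos (\<xi> \<bullet> x) \<partial>\<mu>)) = (\<integral>\<^sup>+x. ennreal (1 - cos (\<xi> \<bullet> x)) \<partial>\<mu>)" by (simp add: nn)
  also have "\<dots> \<le> (\<integral>\<^sup>+x. ennreal (2 * ?m) * ennreal (min 1 (((u *\<^sub>R \<xi>) \<bullet> x)\<^sup>2)) \<partial>\<mu>)"
    using trunc m by (intro nn_integral_mono) (simp add: ennreal_mult[symmetric] ennreal_leI del: inner_scaleR_left)
  also have "\<dots> = ennreal (2 * ?m) * (\<integral>\<^sup>+x. ennreal (min 1 (((u *\<^sub>R \<xi>) \<bullet> x)\<^sup>2)) \<partial>\<mu>)"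
    by (rule nn_integral_cmult) measurable
  also have "\<dots> \<le> ennreal (2 * ?m) * (ennreal (32 * 2 ^ DIM('a)) * ennreal (1 - (\<integral>x. cos ((u *\<^sub>R \<xi>) \<bullet> x) \<partial>\<mu>)))"
    unfolding nn[symmetric]
    by (intro mult_left_mono isotropic_unimodal_integral_one_minus_cos_ge \<mu>(1)) auto
  also have "\<dots> = ennreal (2 * ?m * (32 * 2 ^ DIM('a) * (1 - (\<integral>x. cos ((u *\<^sub>R \<xi>) \<bullet> x) \<partial>\<mu>))))"
    using m by (subst ennreal_mult'[symmetric], simp, subst ennreal_mult'[symmetric]) auto
  finally have "ennreal (1 - (\<integral>x. cos (\<xi> \<bullet> x) \<partial>\<mu>)) \<le> \<dots>" .
  moreover have "0 \<le> 1 - (\<integral>x. cos ((u *\<^sub>R \<xi>) \<bullet> x) \<partial>\<mu>)"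
  proof -
    have "(\<integral>x. cos ((u *\<^sub>R \<xi>) \<bullet> x) \<partial>\<mu>) \<le> 1"
      by (rule integral_le_const) (auto intro!: integrable_const_bound[where B=1])
    then show ?thesis by linarith
  qed
  ultimately have "1 - (\<integral>x. cos (\<xi> \<bullet> x) \<partial>\<mu>) \<le> 2 * ?m * (32 * 2 ^ DIM('a) * (1 - (\<integral>x. cos ((u *\<^sub>R \<xi>) \<bullet> x) \<partial>\<mu>)))"
    using m by (subst (asm) ennreal_le_iff) (auto intro!: mult_nonneg_nonneg)
  then show ?thesis by (simp only: mult_ac) simp
qed

text \<open>
  The exponent is the limit of \<open>(1 - exp (- t \<psi>)) / t\<close> as \<open>t \<rightarrow> 0\<close>, so it inherits the inequality
  satisfied by the laws of the process. For \<open>u \<ge> 1\<close> this says that \<open>\<psi>\<close> is almost increasing along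
  rays, for \<open>u \<le> 1\<close> that it grows at most quadratically.
\<close>

lemma levy_khintchine_exponent_almost_increasing:
  fixes X :: "real \<Rightarrow> 'w \<Rightarrow> 'a::euclidean_space"
  assumes X: "isotropic_unimodal_levy_process M X" "levy_khintchine_exponent M X \<psi>" and u: "0 < u"
  shows "\<psi> \<xi> \<le> 64 * 2 ^ DIM('a) * max 1 (1 / u\<^sup>2) * \<psi> (u *\<^sub>R \<xi>)"
proof -
  have lp: "levy_process M X" and uni: "\<And>t. 0 < t \<Longrightarrow> isotropic_unimodal (distr M borel (X t))"
    using X(1) unfolding isotropic_unimodal_levy_process_def isotropic_levy_process_def by auto
  have lim: "((\<lambda>t. (1 - exp (- (t * a))) / t) \<longlongrightarrow> a) (at_right 0)" for a :: real
  proof -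
    have "((\<lambda>t. 1 - exp (- (t * a))) has_real_derivative a) (at 0)"
      by (auto intro!: derivative_eq_intros)
    then have "((\<lambda>t. (1 - exp (- (t * a))) / t) \<longlongrightarrow> a) (at 0)"
      by (simp add: DERIV_def)
    then show ?thesis by (simp add: filterlim_at_split)
  qed
  let ?C = "64 * 2 ^ DIM('a) * max 1 (1 / u\<^sup>2)"
  show ?thesis
  proof (rule tendsto_le[OF _ tendsto_mult[OF tendsto_const lim] lim])
    show "\<forall>\<^sub>F t in at_right 0. (1 - exp (- (t * \<psi> \<xi>))) / t \<le> ?C * ((1 - exp (- (t * \<psi> (u *\<^sub>R \<xi>)))) / t)"
      using eventually_at_right_less[of "0::real"]
    proof eventually_elim
      case (elim t)
      have "1 - exp (- (t * \<psi> \<xi>)) \<le> ?C * (1 - exp (- (t * \<psi> (u *\<^sub>R \<xi>))))"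
        using isotropic_unimodal_one_minus_cos_almost_increasing[OF uni[OF elim] levy_process_prob_space_distr[OF lp less_imp_le[OF elim]] u, of \<xi>]
        unfolding levy_khintchine_exponent_cos[OF lp X(2) less_imp_le[OF elim]] by simp
      then have "(1 - exp (- (t * \<psi> \<xi>))) / t \<le> ?C * (1 - exp (- (t * \<psi> (u *\<^sub>R \<xi>)))) / t"
        using elim by (intro divide_right_mono) auto
      then show ?case by simp
    qed
  qed simp
qed

text \<open>
  Regular variation makes \<open>\<psi>\<close> positive near the origin; almost monotonicity propagates this to
  all \<open>\<xi> \<noteq> 0\<close>.
\<close>

lemma levy_khintchine_exponent_pos:
  fixes X :: "real \<Rightarrow> 'w \<Rightarrow> real ^ 'n"
  assumes X: "isotropic_unimodal_levy_process M X" "levy_khintchine_exponent M X \<psi>"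
    and rv: "regularly_varying_at_zero \<alpha> (radial_profile \<psi>)" and \<xi>: "\<xi> \<noteq> 0"
  shows "0 < \<psi> \<xi>"
proof -
  have iso: "isotropic_levy_process M X"
    using X(1) by (simp add: isotropic_unimodal_levy_process_def)
  obtain x0 where x0: "0 < x0" "\<And>x. x0 \<le> x \<Longrightarrow> 0 < inverse (radial_profile \<psi> (inverse x))"
    using rv unfolding regularly_varying_at_zero_def regularly_varying_at_infinity_def by blast
  \<comment> \<open>The factor \<open>1 / u\<close> moves \<open>\<xi>\<close> to the radius \<open>1 / x0\<close>, where positivity is known.\<close>
  define u where "u = norm \<xi> * x0"
  have u: "0 < u" using \<xi> x0 by (simp add: u_def)
  have "0 < radial_profile \<psi> (inverse x0)" using x0(2)[of x0] by simp
  also have "radial_profile \<psi> (inverse x0) = \<psi> (inverse u *\<^sub>R \<xi>)"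
  proof -
    have "norm (inverse u *\<^sub>R \<xi>) = inverse x0"
      using \<xi> x0(1) by (simp add: u_def field_simps)
    then show ?thesis by (simp add: levy_khintchine_exponent_eq_radial_profile[OF iso X(2)])
  qed
  also have "\<dots> \<le> 64 * 2 ^ DIM(real ^ 'n) * max 1 (1 / u\<^sup>2) * \<psi> (u *\<^sub>R (inverse u *\<^sub>R \<xi>))"
    by (rule levy_khintchine_exponent_almost_increasing[OF X u])
  finally have "0 < 64 * 2 ^ DIM(real ^ 'n) * max 1 (1 / u\<^sup>2) * \<psi> \<xi>" using u by simp
  then show ?thesis by (rule zero_less_mult_pos) (simp add: less_max_iff_disj)
qed

section \<open>The radial potential measure and its Laplace transform\<close>

text \<open>
  Stochastic continuity of the process gives weak continuity of its laws, here tested on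
  Lipschitz functions.
\<close>

lemma levy_process_expectation_continuous:
  fixes X :: "real \<Rightarrow> 'w \<Rightarrow> 'a::euclidean_space" and f :: "'a \<Rightarrow> real"
  assumes X: "levy_process M X" and f: "\<And>x. 0 \<le> f x" "\<And>x. f x \<le> 1" "\<And>x y. \<bar>f x - f y\<bar> \<le> K * dist x y"
  shows "continuous_on {0..} (\<lambda>t. \<integral>\<omega>. f (X t \<omega>) \<partial>M)"
proof -
  interpret prob_space M using X by (simp add: levy_process_def)
  have meas: "X t \<in> borel_measurable M" if "0 \<le> t" for t using X that by (simp add: levy_process_def)
  have stoch: "((\<lambda>s. measure M {\<omega> \<in> space M. norm (X s \<omega> - X t \<omega>) > e}) \<longlongrightarrow> 0) (at t within {0..})"
    if "0 \<le> t" "0 < e" for t e using X that by (simp add: levy_process_def)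
  have K: "0 \<le> K"
  proof -
    obtain b :: 'a where "b \<in> Basis" using nonempty_Basis by blast
    then have "0 \<le> K * norm b" using f(3)[of b 0] by (simp add: dist_norm)
    then show ?thesis using \<open>b \<in> Basis\<close> by simp
  qed
  have "continuous_on UNIV f"
  proof (rule lipschitz_on_continuous_on)
    show "K-lipschitz_on UNIV f" by (rule lipschitz_onI) (use f(3) K in \<open>auto simp: dist_real_def\<close>)
  qed
  then have [measurable]: "f \<in> borel_measurable borel" by (rule borel_measurable_continuous_onI)
  have int: "integrable M (\<lambda>\<omega>. f (X t \<omega>))" if "0 \<le> t" for t
    using f meas[OF that] by (intro integrable_const_bound[where B=1]) auto
  have diff: "\<bar>(\<integral>\<omega>. f (X s \<omega>) \<partial>M) - (\<integral>\<omega>. f (X t \<omega>) \<partial>M)\<bar> \<le> K * e + measure M {\<omega> \<in> space M. norm (X s \<omega> - X t \<omega>) > e}"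
    if st: "0 \<le> s" "0 \<le> t" "0 < e" for s t e
  proof -
    note [measurable] = meas[OF st(1)] meas[OF st(2)]
    let ?B = "{\<omega> \<in> space M. norm (X s \<omega> - X t \<omega>) > e}"
    have B: "?B \<in> sets M" by measurable
    have iB: "integrable M (indicator ?B :: _ \<Rightarrow> real)" using B by (simp add: emeasure_eq_measure)
    have "\<bar>(\<integral>\<omega>. f (X s \<omega>) \<partial>M) - (\<integral>\<omega>. f (X t \<omega>) \<partial>M)\<bar> = \<bar>\<integral>\<omega>. f (X s \<omega>) - f (X t \<omega>) \<partial>M\<bar>"
      using int st by simp
    also have "\<dots> \<le> (\<integral>\<omega>. K * e + indicator ?B \<omega> \<partial>M)"
    proof (rule integral_abs_bound[THEN order_trans], rule integral_mono)
      fix \<omega> assume \<omega>: "\<omega> \<in> space M"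
      show "\<bar>f (X s \<omega>) - f (X t \<omega>)\<bar> \<le> K * e + indicator ?B \<omega>"
      proof (cases "\<omega> \<in> ?B")
        case True
        have "\<bar>f (X s \<omega>) - f (X t \<omega>)\<bar> \<le> 1" using f(1,2)[of "X s \<omega>"] f(1,2)[of "X t \<omega>"] by linarith
        moreover have "0 \<le> K * e" using K st by simp
        ultimately show ?thesis using True by simp
      next
        case False
        then have "K * dist (X s \<omega>) (X t \<omega>) \<le> K * e"
          using \<omega> K by (intro mult_left_mono) (auto simp: dist_norm)
        then show ?thesis using f(3)[of "X s \<omega>" "X t \<omega>"] False by simp
      qed
    qed (use int st iB in auto)
    also have "\<dots> = K * e + measure M ?B"
      using iB B by (simp add: prob_space)
    finally show ?thesis .
  qed
  show ?thesis
    unfolding continuous_on_def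
  proof (intro ballI tendstoI)
    fix t \<epsilon> :: real assume t: "t \<in> {0..}" and \<epsilon>: "0 < \<epsilon>"
    define e where "e = \<epsilon> / (2 * (K + 1))"
    have e: "0 < e" "K * e \<le> \<epsilon> / 2" using K \<epsilon> by (auto simp: e_def field_simps)
    have "\<forall>\<^sub>F s in at t within {0..}. measure M {\<omega> \<in> space M. norm (X s \<omega> - X t \<omega>) > e} < \<epsilon> / 2"
      using stoch[of t e] t e \<epsilon> by (intro order_tendstoD) auto
    moreover have "\<forall>\<^sub>F s in at t within {0..}. s \<in> {0..}" by (simp add: eventually_at_filter)
    ultimately show "\<forall>\<^sub>F s in at t within {0..}. dist (\<integral>\<omega>. f (X s \<omega>) \<partial>M) (\<integral>\<omega>. f (X t \<omega>) \<partial>M) < \<epsilon>"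
    proof eventually_elim
      case (elim s)
      then show ?case using diff[of s t e] t e unfolding dist_real_def by auto
    qed
  qed
qed

text \<open>
  The indicator of a closed ball is the decreasing limit of Lipschitz cutoffs, whose
  expectations are continuous in time.
\<close>

lemma levy_process_norm_distribution_measurable:
  fixes X :: "real \<Rightarrow> 'w \<Rightarrow> 'a::euclidean_space"
  assumes X: "levy_process M X"
  shows "(\<lambda>t. measure M {\<omega> \<in> space M. norm (X t \<omega>) \<le> b}) \<in> borel_measurable (restrict_space borel {0..})"
proof -
  interpret prob_space M using X by (simp add: levy_process_def)
  have meas: "X t \<in> borel_measurable M" if "0 \<le> t" for t using X that by (simp add: levy_process_def)
  define F where "F n r = max 0 (1 - real n * max 0 (r - b))" for n r
  have F01: "0 \<le> F n r" "F n r \<le> 1" for n r by (auto simp: F_def)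
  have F_lip: "\<bar>F n (norm x) - F n (norm y)\<bar> \<le> real n * dist x y" for n and x y :: 'a
  proof -
    have "\<bar>F n (norm x) - F n (norm y)\<bar> \<le> \<bar>real n * max 0 (norm x - b) - real n * max 0 (norm y - b)\<bar>"
      unfolding F_def by linarith
    also have "\<dots> = real n * \<bar>max 0 (norm x - b) - max 0 (norm y - b)\<bar>"
      by (simp add: right_diff_distrib[symmetric] abs_mult)
    also have "\<dots> \<le> real n * \<bar>norm x - norm y\<bar>" by (intro mult_left_mono) linarith+
    also have "\<dots> \<le> real n * dist x y" by (intro mult_left_mono) (auto simp: dist_norm norm_triangle_ineq3)
    finally show ?thesis .
  qed
  have [measurable]: "F n \<in> borel_measurable borel" for n unfolding F_def by measurable
  have F_lim: "(\<lambda>n. F n r) \<longlonglongrightarrow> indicator {..b} r" for r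
  proof (cases "r \<le> b")
    case True
    then show ?thesis by (simp add: F_def)
  next
    case False
    obtain n0 where n0: "1 / (r - b) < real n0" using reals_Archimedean2 by blast
    \<comment> \<open>Beyond \<open>b\<close> the cutoff vanishes as soon as \<open>n (r - b) \<ge> 1\<close>.\<close>
    have "\<forall>\<^sub>F n in sequentially. F n r = 0"
      using eventually_ge_at_top[of n0]
    proof eventually_elim
      case (elim n)
      then have "1 / (r - b) < real n" using n0 by linarith
      then show ?case using False by (simp add: F_def field_simps)
    qed
    then show ?thesis using False by (simp add: tendsto_eventually)
  qed
  show ?thesis
  proof (rule borel_measurable_LIMSEQ_real)
    fix n show "(\<lambda>t. \<integral>\<omega>. F n (norm (X t \<omega>)) \<partial>M) \<in> borel_measurable (restrict_space borel {0..})"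
      by (intro borel_measurable_continuous_on_restrict levy_process_expectation_continuous[OF X _ _ F_lip]) (auto simp: F01)
  next
    fix t assume "t \<in> space (restrict_space borel {0::real..})"
    then have t: "0 \<le> t" by (simp add: space_restrict_space)
    note [measurable] = meas[OF t]
    have "(\<lambda>n. \<integral>\<omega>. F n (norm (X t \<omega>)) \<partial>M) \<longlonglongrightarrow> (\<integral>\<omega>. indicator {..b} (norm (X t \<omega>)) \<partial>M)"
      by (rule integral_dominated_convergence[where w="\<lambda>_. 1"]) (auto simp: F01 F_lim)
    also have "(\<integral>\<omega>. indicator {..b} (norm (X t \<omega>)) \<partial>M) = (\<integral>\<omega>. indicator {\<omega> \<in> space M. norm (X t \<omega>) \<le> b} \<omega> \<partial>M)"
      by (intro Bochner_Integration.integral_cong) (auto simp: indicator_def)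
    also have "\<dots> = measure M {\<omega> \<in> space M. norm (X t \<omega>) \<le> b}" by (simp add: Int_absorb2)
    finally show "(\<lambda>n. \<integral>\<omega>. F n (norm (X t \<omega>)) \<partial>M) \<longlonglongrightarrow> measure M {\<omega> \<in> space M. norm (X t \<omega>) \<le> b}" .
  qed
qed

text \<open>
  The image of the potential measure under \<open>x \<mapsto> |x|\<^sup>2\<close>, realised as the mixture of the laws of
  \<open>|X t|\<^sup>2\<close> over Lebesgue time, so that its integrals are iterated integrals.
\<close>

definition radial_potential_measure ::
    "'w measure \<Rightarrow> (real \<Rightarrow> 'w \<Rightarrow> 'a::euclidean_space) \<Rightarrow> real measure" where
  "radial_potential_measure M X =
     restrict_space lborel {0..} \<bind> (\<lambda>t. distr M borel (\<lambda>\<omega>. (norm (X t \<omega>))\<^sup>2))"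

lemma levy_process_radial_kernel:
  fixes X :: "real \<Rightarrow> 'w \<Rightarrow> 'a::euclidean_space"
  assumes X: "levy_process M X"
  shows "(\<lambda>t. distr M borel (\<lambda>\<omega>. (norm (X t \<omega>))\<^sup>2)) \<in> restrict_space lborel {0..} \<rightarrow>\<^sub>M subprob_algebra borel"
proof -
  interpret prob_space M using X by (simp add: levy_process_def)
  have meas: "X t \<in> borel_measurable M" if "0 \<le> t" for t using X that by (simp add: levy_process_def)
  have prob: "prob_space (distr M borel (\<lambda>\<omega>. (norm (X t \<omega>))\<^sup>2))" if "0 \<le> t" for t
    using meas[OF that] by (intro prob_space_distr) auto
  have sub: "t \<in> space (restrict_space lborel {0..}) \<Longrightarrow> 0 \<le> t" for t :: real
    by (simp add: space_restrict_space)
  show ?thesis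
  proof (rule measurable_subprob_algebra_generated[where \<Omega>=UNIV and G="range atMost"])
    show "sets (borel :: real measure) = sigma_sets UNIV (range atMost)"
      by (simp add: borel_eq_atMost sets_measure_of_conv)
    show "Int_stable (range atMost :: real set set)" by (auto simp: Int_stable_def)
    fix t assume "t \<in> space (restrict_space lborel {0::real..})"
    then show "subprob_space (distr M borel (\<lambda>\<omega>. (norm (X t \<omega>))\<^sup>2))"
      by (intro prob_space_imp_subprob_space prob sub)
  next
    fix A :: "real set" assume "A \<in> range atMost"
    then obtain a where A: "A = {..a}" by blast
    show "(\<lambda>t. emeasure (distr M borel (\<lambda>\<omega>. (norm (X t \<omega>))\<^sup>2)) A) \<in> borel_measurable (restrict_space lborel {0..})"
    proof (cases "0 \<le> a")
      case True
      have "emeasure (distr M borel (\<lambda>\<omega>. (norm (X t \<omega>))\<^sup>2)) A = ennreal (measure M {\<omega> \<in> space M. norm (X t \<omega>) \<le> sqrt a})"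
        if "t \<in> space (restrict_space lborel {0::real..})" for t
      proof -
        note [measurable] = meas[OF sub[OF that]]
        have "(\<lambda>\<omega>. (norm (X t \<omega>))\<^sup>2) -` {..a} \<inter> space M = {\<omega> \<in> space M. norm (X t \<omega>) \<le> sqrt a}"
          using True by (auto simp: real_le_rsqrt) (metis norm_ge_zero real_sqrt_le_iff real_sqrt_pow2 real_sqrt_power power_mono real_sqrt_ge_zero)
        then show ?thesis unfolding A by (subst emeasure_distr) (auto simp: emeasure_eq_measure)
      qed
      moreover have "(\<lambda>t. ennreal (measure M {\<omega> \<in> space M. norm (X t \<omega>) \<le> sqrt a})) \<in> borel_measurable (restrict_space lborel {0..})"
        using levy_process_norm_distribution_measurable[OF X, of "sqrt a"]
        by (intro measurable_compose[OF _ measurable_ennreal]) (simp cong: measurable_cong_sets restrict_space_sets_cong)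
      ultimately show ?thesis by (subst measurable_cong)
    next
      case False
      have "emeasure (distr M borel (\<lambda>\<omega>. (norm (X t \<omega>))\<^sup>2)) A = 0"
        if "t \<in> space (restrict_space lborel {0::real..})" for t
      proof -
        note [measurable] = meas[OF sub[OF that]]
        have "\<not> (norm (X t \<omega>))\<^sup>2 \<le> a" for \<omega>
          using False zero_le_power2[of "norm (X t \<omega>)"] by linarith
        then have "(\<lambda>\<omega>. (norm (X t \<omega>))\<^sup>2) -` {..a} \<inter> space M = {}" by auto
        then show ?thesis unfolding A by (subst emeasure_distr) auto
      qed
      then show ?thesis by (subst measurable_cong[where g="\<lambda>_. 0"]) auto
    qed
  next
    have "emeasure (distr M borel (\<lambda>\<omega>. (norm (X t \<omega>))\<^sup>2)) UNIV = 1"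
      if "t \<in> space (restrict_space lborel {0::real..})" for t
      using prob_space.emeasure_space_1[OF prob[OF sub[OF that]]] by simp
    then show "(\<lambda>t. emeasure (distr M borel (\<lambda>\<omega>. (norm (X t \<omega>))\<^sup>2)) UNIV) \<in> borel_measurable (restrict_space lborel {0..})"
      by (subst measurable_cong[where g="\<lambda>_. 1"]) auto
  qed auto
qed

lemma sets_radial_potential_measure:
  assumes "levy_process M X"
  shows "sets (radial_potential_measure M X) = sets borel"
  unfolding radial_potential_measure_def
  by (rule sets_bind[OF sets_kernel[OF levy_process_radial_kernel[OF assms]]]) (auto simp: space_restrict_space)

lemma nn_integral_radial_potential_measure:
  fixes X :: "real \<Rightarrow> 'w \<Rightarrow> 'a::euclidean_space"
  assumes X: "levy_process M X" and f [measurable]: "f \<in> borel_measurable borel"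
  shows "(\<integral>\<^sup>+s. f s \<partial>radial_potential_measure M X)
    = (\<integral>\<^sup>+t\<in>{0..}. (\<integral>\<^sup>+x. f ((norm x)\<^sup>2) \<partial>distr M borel (X t)) \<partial>lborel)"
proof -
  have "(\<integral>\<^sup>+s. f s \<partial>radial_potential_measure M X)
     = (\<integral>\<^sup>+t. (\<integral>\<^sup>+s. f s \<partial>distr M borel (\<lambda>\<omega>. (norm (X t \<omega>))\<^sup>2)) \<partial>restrict_space lborel {0..})"
    unfolding radial_potential_measure_def by (rule nn_integral_bind[OF f levy_process_radial_kernel[OF X]])
  also have "\<dots> = (\<integral>\<^sup>+t. (\<integral>\<^sup>+x. f ((norm x)\<^sup>2) \<partial>distr M borel (X t)) \<partial>restrict_space lborel {0..})"
  proof (rule nn_integral_cong)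
    fix t assume "t \<in> space (restrict_space lborel {0::real..})"
    then have [measurable]: "X t \<in> borel_measurable M" using X by (simp add: levy_process_def space_restrict_space)
    show "(\<integral>\<^sup>+s. f s \<partial>distr M borel (\<lambda>\<omega>. (norm (X t \<omega>))\<^sup>2)) = (\<integral>\<^sup>+x. f ((norm x)\<^sup>2) \<partial>distr M borel (X t))"
      by (simp add: nn_integral_distr)
  qed
  also have "\<dots> = (\<integral>\<^sup>+t\<in>{0..}. (\<integral>\<^sup>+x. f ((norm x)\<^sup>2) \<partial>distr M borel (X t)) \<partial>lborel)"
    by (rule nn_integral_restrict_space) auto
  finally show ?thesis .
qed

lemma potential_measure_cball_eq:
  fixes X :: "real \<Rightarrow> 'w \<Rightarrow> 'a::euclidean_space"
  assumes X: "levy_process M X" and r: "0 \<le> r"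
  shows "potential_measure M X {x. norm x \<le> r} = emeasure (radial_potential_measure M X) {..r\<^sup>2}"
proof -
  have "emeasure (radial_potential_measure M X) {..r\<^sup>2} = (\<integral>\<^sup>+s. indicator {..r\<^sup>2} s \<partial>radial_potential_measure M X)"
    by (simp add: sets_radial_potential_measure[OF X])
  also have "\<dots> = (\<integral>\<^sup>+t\<in>{0..}. (\<integral>\<^sup>+x. indicator {..r\<^sup>2} ((norm x)\<^sup>2) \<partial>distr M borel (X t)) \<partial>lborel)"
    by (rule nn_integral_radial_potential_measure[OF X]) auto
  also have "(\<lambda>x::'a. indicator {..r\<^sup>2} ((norm x)\<^sup>2) :: ennreal) = indicator {x. norm x \<le> r}"
    using r by (auto simp: indicator_def fun_eq_iff power_mono_iff abs_le_square_iff[symmetric])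
  finally show ?thesis by (simp add: potential_measure_def)
qed

text \<open>
  Fubini applied to a Gaussian vector independent of the given law: averaging the characters over
  the Gaussian first yields \<open>exp (- a |x|\<^sup>2)\<close>.
\<close>

lemma integral_exp_norm_square_eq_gaussian_average:
  fixes N :: "'a::euclidean_space measure"
  assumes N: "prob_space N" and sets_N [measurable_cong]: "sets N = sets borel" and a: "0 \<le> a"
  shows "(\<integral>x. exp (- (a * (norm x)\<^sup>2)) \<partial>N) = (\<integral>y. (\<integral>x. cos ((sqrt (2 * a) *\<^sub>R y) \<bullet> x) \<partial>N) \<partial>standard_gaussian)"
proof -
  interpret N: prob_space N by (rule N)
  interpret \<gamma>: prob_space "standard_gaussian :: 'a measure" by (rule prob_space_standard_gaussian)
  interpret P: pair_prob_space N "standard_gaussian :: 'a measure" ..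
  have "(\<integral>y. (\<integral>x. cos ((sqrt (2 * a) *\<^sub>R y) \<bullet> x) \<partial>N) \<partial>standard_gaussian)
      = (\<integral>x. (\<integral>y. cos ((sqrt (2 * a) *\<^sub>R y) \<bullet> x) \<partial>standard_gaussian) \<partial>N)"
    by (rule P.Fubini_integral) (rule P.integrable_const_bound[where B=1], auto simp: case_prod_beta)
  also have "\<dots> = (\<integral>x. exp (- (a * (norm x)\<^sup>2)) \<partial>N)"
  proof (intro Bochner_Integration.integral_cong refl)
    fix x
    have "(\<integral>y. cos ((sqrt (2 * a) *\<^sub>R y) \<bullet> x) \<partial>standard_gaussian) = (\<integral>y. cos ((sqrt (2 * a) *\<^sub>R x) \<bullet> y) \<partial>standard_gaussian)"
      by (simp add: inner_commute)
    also have "\<dots> = exp (- (a * (norm x)\<^sup>2))"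
      unfolding standard_gaussian_characteristic_function using a by (simp add: power_mult_distrib)
    finally show "(\<integral>y. cos ((sqrt (2 * a) *\<^sub>R y) \<bullet> x) \<partial>standard_gaussian) = exp (- (a * (norm x)\<^sup>2))" .
  qed
  finally show ?thesis ..
qed

lemma nn_integral_exp_decay:
  fixes a :: real assumes "0 < a"
  shows "(\<integral>\<^sup>+t\<in>{0..}. ennreal (exp (- (t * a))) \<partial>lborel) = ennreal (1 / a)"
proof -
  have "((\<lambda>t. exp (- (t * a))) \<longlongrightarrow> 0) at_top"
    by (intro filterlim_compose[OF exp_at_bot] filterlim_uminus_at_bot_at_top filterlim_compose[OF filterlim_uminus_at_bot_at_top]
        filterlim_at_top_mult_tendsto_pos[OF tendsto_const assms filterlim_ident])
  then have "((\<lambda>t. - exp (- (t * a)) / a) \<longlongrightarrow> - 0 / a) at_top"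
    using assms by (intro tendsto_intros) auto
  then have "(\<integral>\<^sup>+t. ennreal (exp (- (t * a))) * indicator {0..} t \<partial>lborel) = ennreal (0 - (- exp (- (0 * a)) / a))"
    using assms by (intro nn_integral_FTC_atLeast) (auto intro!: derivative_eq_intros)
  then show ?thesis by simp
qed

text \<open>
  The bridge between \<open>G\<close> and \<open>\<psi>\<close>: insert the Gaussian average for each \<open>t\<close> and integrate over time
  first, using that \<open>exp (- t \<psi>)\<close> has integral \<open>1 / \<psi>\<close>.
\<close>

lemma radial_potential_measure_laplace:
  fixes X :: "real \<Rightarrow> 'w \<Rightarrow> 'a::euclidean_space"
  assumes X: "levy_process M X" "levy_khintchine_exponent M X \<psi>"
    and pos: "\<And>\<xi>. \<xi> \<noteq> 0 \<Longrightarrow> 0 < \<psi> \<xi>" and a: "0 < a"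
  shows "(\<integral>\<^sup>+s. ennreal (exp (- (a * s))) \<partial>radial_potential_measure M X)
    = (\<integral>\<^sup>+y. ennreal (1 / \<psi> (sqrt (2 * a) *\<^sub>R y)) \<partial>standard_gaussian)"
proof -
  interpret \<gamma>: prob_space "standard_gaussian :: 'a measure" by (rule prob_space_standard_gaussian)
  interpret pair_sigma_finite lborel "standard_gaussian :: 'a measure" ..
  have [measurable]: "\<psi> \<in> borel_measurable borel" by (rule levy_khintchine_exponent_measurable[OF X])
  have inner: "(\<integral>\<^sup>+x. ennreal (exp (- (a * (norm x)\<^sup>2))) \<partial>distr M borel (X t))
      = (\<integral>\<^sup>+y. ennreal (exp (- (t * \<psi> (sqrt (2 * a) *\<^sub>R y)))) \<partial>standard_gaussian)" if t: "0 \<le> t" for t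
  proof -
    interpret N: prob_space "distr M borel (X t)" using X(1) t by (rule levy_process_prob_space_distr)
    have "(\<integral>\<^sup>+x. ennreal (exp (- (a * (norm x)\<^sup>2))) \<partial>distr M borel (X t)) = ennreal (\<integral>x. exp (- (a * (norm x)\<^sup>2)) \<partial>distr M borel (X t))"
      using a by (intro nn_integral_eq_integral N.integrable_const_bound[where B=1]) auto
    also have "(\<integral>x. exp (- (a * (norm x)\<^sup>2)) \<partial>distr M borel (X t)) = (\<integral>y. exp (- (t * \<psi> (sqrt (2 * a) *\<^sub>R y))) \<partial>standard_gaussian)"
      using integral_exp_norm_square_eq_gaussian_average[OF N.prob_space_axioms _ less_imp_le[OF a]]
      unfolding levy_khintchine_exponent_cos[OF X t] by simp
    also have "ennreal \<dots> = (\<integral>\<^sup>+y. ennreal (exp (- (t * \<psi> (sqrt (2 * a) *\<^sub>R y)))) \<partial>standard_gaussian)"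
      using t levy_khintchine_exponent_nonneg[OF X]
      by (intro nn_integral_eq_integral[symmetric] \<gamma>.integrable_const_bound[where B=1]) auto
    finally show ?thesis .
  qed
  have "(\<integral>\<^sup>+s. ennreal (exp (- (a * s))) \<partial>radial_potential_measure M X)
    = (\<integral>\<^sup>+t\<in>{0..}. (\<integral>\<^sup>+x. ennreal (exp (- (a * (norm x)\<^sup>2))) \<partial>distr M borel (X t)) \<partial>lborel)"
    by (rule nn_integral_radial_potential_measure[OF X(1)]) measurable
  also have "\<dots> = (\<integral>\<^sup>+t. (\<integral>\<^sup>+y. ennreal (exp (- (t * \<psi> (sqrt (2 * a) *\<^sub>R y)))) * indicator {0..} t \<partial>standard_gaussian) \<partial>lborel)"
    by (intro nn_integral_cong) (auto simp: indicator_def inner)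
  also have "\<dots> = (\<integral>\<^sup>+y. (\<integral>\<^sup>+t. ennreal (exp (- (t * \<psi> (sqrt (2 * a) *\<^sub>R y)))) * indicator {0..} t \<partial>lborel) \<partial>standard_gaussian)"
    by (rule Fubini'[symmetric]) measurable
  also have "\<dots> = (\<integral>\<^sup>+y. ennreal (1 / \<psi> (sqrt (2 * a) *\<^sub>R y)) \<partial>standard_gaussian)"
  proof (rule nn_integral_cong_AE)
    have "AE y in standard_gaussian. (y :: 'a) \<noteq> 0"
      unfolding standard_gaussian_def using AE_lborel_singleton[of "0::'a"]
      by (subst AE_density) auto
    then show "AE y in standard_gaussian. (\<integral>\<^sup>+t. ennreal (exp (- (t * \<psi> (sqrt (2 * a) *\<^sub>R y)))) * indicator {0..} t \<partial>lborel)
        = ennreal (1 / \<psi> (sqrt (2 * a) *\<^sub>R y))"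
      by eventually_elim (use a in \<open>auto intro!: nn_integral_exp_decay pos\<close>)
  qed
  finally show ?thesis .
qed

section \<open>Asymptotics of the potential measure\<close>

lemma regularly_varying_at_infinity_sqrt:
  assumes "regularly_varying_at_infinity \<alpha> f"
  shows "regularly_varying_at_infinity (\<alpha> / 2) (\<lambda>x. f (sqrt x))"
proof -
  obtain x0 where x0: "0 < x0" "\<And>x. x0 \<le> x \<Longrightarrow> 0 < f x"
    and lim: "\<And>c. 0 < c \<Longrightarrow> ((\<lambda>x. f (c * x) / f x) \<longlongrightarrow> c powr \<alpha>) at_top"
    using assms unfolding regularly_varying_at_infinity_def by blast
  have "0 < f (sqrt x)" if "x0\<^sup>2 \<le> x" for x
    using x0 that by (intro x0(2) real_le_rsqrt)
  moreover have "((\<lambda>x. f (sqrt (c * x)) / f (sqrt x)) \<longlongrightarrow> c powr (\<alpha> / 2)) at_top" if "0 < c" for c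
  proof -
    have "((\<lambda>x. f (sqrt c * sqrt x) / f (sqrt x)) \<longlongrightarrow> sqrt c powr \<alpha>) at_top"
      using that by (intro filterlim_compose[OF lim sqrt_at_top]) auto
    then show ?thesis
      using that by (simp add: real_sqrt_mult powr_half_sqrt[symmetric] powr_powr)
  qed
  ultimately show ?thesis
    unfolding regularly_varying_at_infinity_def using x0(1)
    by (intro conjI exI[of _ "x0\<^sup>2"] allI impI) auto
qed

text \<open>
  Dominated convergence. The majorant comes from \<open>scaling\<close> with \<open>u = sqrt 2 * norm y\<close>, which
  compares \<open>\<psi>\<close> at radius \<open>1 / sqrt x\<close> with its value at \<open>sqrt (2 / x) *\<^sub>R y\<close>; it is a multiple of
  \<open>1 + 1 / (2 |y|\<^sup>2)\<close>, which is integrable in dimension at least three.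
\<close>

lemma gaussian_average_inverse_regularly_varying:
  fixes \<psi> :: "'a::euclidean_space \<Rightarrow> real" and \<Psi> :: "real \<Rightarrow> real"
  assumes dim: "DIM('a) \<ge> 3" and \<alpha>: "\<alpha> \<le> 2"
    and meas [measurable]: "\<psi> \<in> borel_measurable borel"
    and radial: "\<And>\<xi>. \<psi> \<xi> = \<Psi> (norm \<xi>)"
    and pos: "\<And>\<xi>. \<xi> \<noteq> 0 \<Longrightarrow> 0 < \<psi> \<xi>"
    and scaling: "\<And>u \<xi>. 0 < u \<Longrightarrow> \<psi> \<xi> \<le> C * max 1 (1 / u\<^sup>2) * \<psi> (u *\<^sub>R \<xi>)"
    and C: "0 \<le> C"
    and rv: "regularly_varying_at_zero \<alpha> \<Psi>"
  shows "\<And>x. 0 < x \<Longrightarrow> integrable standard_gaussian (\<lambda>y. \<Psi> (inverse (sqrt x)) / \<psi> (sqrt (2 / x) *\<^sub>R y))"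
    and "((\<lambda>x. \<integral>y. \<Psi> (inverse (sqrt x)) / \<psi> (sqrt (2 / x) *\<^sub>R y) \<partial>standard_gaussian) \<longlongrightarrow>
          2 powr (- \<alpha>) * Gamma ((real DIM('a) - \<alpha>) / 2) / Gamma (real DIM('a) / 2)) at_top"
proof -
  let ?\<gamma> = "standard_gaussian :: 'a measure"
  interpret \<gamma>: prob_space ?\<gamma> by (rule prob_space_standard_gaussian)
  have f_lim: "((\<lambda>x. inverse (\<Psi> (inverse (c * x))) / inverse (\<Psi> (inverse x))) \<longlongrightarrow> c powr \<alpha>) at_top" if "0 < c" for c
    using rv that unfolding regularly_varying_at_zero_def regularly_varying_at_infinity_def by blast
  define D where "D x y = \<Psi> (inverse (sqrt x)) / \<psi> (sqrt (2 / x) *\<^sub>R y)" for x and y :: 'a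
  define w where "w y = C * (1 + 1 / 4 * ((norm y)\<^sup>2 / 2) powr (- 1))" for y :: 'a
  have D_meas [measurable]: "D x \<in> borel_measurable borel" for x unfolding D_def by measurable
  have y_nz: "AE y in ?\<gamma>. y \<noteq> 0"
    unfolding standard_gaussian_def using AE_lborel_singleton[of "0::'a"] by (subst AE_density) auto
  have moment: "(\<integral>\<^sup>+y. ennreal (((norm y)\<^sup>2 / 2) powr (- b)) \<partial>?\<gamma>) = ennreal (Gamma ((real DIM('a) - 2 * b) / 2) / Gamma (real DIM('a) / 2))"
    if "b \<le> 1" for b
    using standard_gaussian_negative_moment[where 'a='a, of b] that dim by (simp add: diff_divide_distrib)
  have w_int: "integrable ?\<gamma> w"
  proof -
    have "integrable ?\<gamma> (\<lambda>y. ((norm y)\<^sup>2 / 2) powr (- 1))"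
      by (rule integrableI_nonneg) (use moment[of 1] in auto)
    then show ?thesis
      unfolding w_def
      by (intro integrable_mult_right Bochner_Integration.integrable_add \<gamma>.integrable_const)
  qed
  have D_bound: "norm (D x y) \<le> w y" if x: "0 < x" and y: "y \<noteq> 0" for x y
  proof -
    let ?u = "sqrt 2 * norm y" and ?\<xi> = "sqrt (1 / x) *\<^sub>R (inverse (norm y) *\<^sub>R y)"
    have u: "0 < ?u" using y by simp
    have D: "D x y = \<psi> ?\<xi> / \<psi> (sqrt (2 / x) *\<^sub>R y)"
      using x y by (simp add: D_def radial real_sqrt_divide inverse_eq_divide)
    have eq: "?u *\<^sub>R ?\<xi> = sqrt (2 / x) *\<^sub>R y"
      using x y by (simp add: real_sqrt_divide)
    have p: "0 < \<psi> (sqrt (2 / x) *\<^sub>R y)" using x y by (intro pos) auto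
    have "\<psi> ?\<xi> \<le> C * max 1 (1 / ?u\<^sup>2) * \<psi> (sqrt (2 / x) *\<^sub>R y)"
      using scaling[OF u, of ?\<xi>] unfolding eq .
    then have "D x y \<le> C * max 1 (1 / ?u\<^sup>2)"
      unfolding D using p by (simp add: divide_simps)
    also have "\<dots> \<le> w y"
    proof -
      have "1 / ?u\<^sup>2 = 1 / 4 * ((norm y)\<^sup>2 / 2) powr (- 1)"
        using y by (simp add: power_mult_distrib powr_minus)
      moreover have "max 1 (1 / ?u\<^sup>2) \<le> 1 + 1 / ?u\<^sup>2" by auto
      ultimately show ?thesis unfolding w_def using C by (intro mult_left_mono) auto
    qed
    finally have "D x y \<le> w y" .
    moreover have "0 \<le> D x y"
      unfolding D using p pos[of ?\<xi>] x y by (intro divide_nonneg_pos) (auto intro: less_imp_le)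
    ultimately show ?thesis by simp
  qed
  have D_lim: "((\<lambda>x. D x y) \<longlongrightarrow> 2 powr (- \<alpha>) * ((norm y)\<^sup>2 / 2) powr (- (\<alpha> / 2))) at_top" if y: "y \<noteq> 0" for y
  proof -
    define z where "z = sqrt 2 * norm y"
    have z: "0 < z" using y by (simp add: z_def)
    have "((\<lambda>x. inverse (\<Psi> (inverse (1 / z * sqrt x))) / inverse (\<Psi> (inverse (sqrt x)))) \<longlongrightarrow> (1 / z) powr \<alpha>) at_top"
      by (rule filterlim_compose[OF f_lim sqrt_at_top]) (use z in simp)
    moreover have "\<forall>\<^sub>F x in at_top. inverse (\<Psi> (inverse (1 / z * sqrt x))) / inverse (\<Psi> (inverse (sqrt x))) = D x y"
      using eventually_gt_at_top[of 0]
    proof eventually_elim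
      case (elim x)
      then show ?case by (simp add: D_def radial z_def real_sqrt_divide inverse_eq_divide mult.commute)
    qed
    moreover have "(1 / z) powr \<alpha> = 2 powr (- \<alpha>) * ((norm y)\<^sup>2 / 2) powr (- (\<alpha> / 2))"
    proof -
      have "(norm y)\<^sup>2 / 2 = (z / 2) powr 2"
        using z by (simp add: z_def power_divide power_mult_distrib)
      then have "((norm y)\<^sup>2 / 2) powr (- (\<alpha> / 2)) = (z / 2) powr (- \<alpha>)"
        by (simp only: powr_powr) simp
      also have "\<dots> = z powr (- \<alpha>) / 2 powr (- \<alpha>)"
        using z by (simp add: powr_divide)
      finally show ?thesis using z by (simp add: powr_divide powr_minus_divide)
    qed
    ultimately show ?thesis by (auto elim: Lim_transform_eventually)
  qed
  have limit_value: "(\<integral>y. 2 powr (- \<alpha>) * ((norm y)\<^sup>2 / 2) powr (- (\<alpha> / 2)) \<partial>?\<gamma>)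
      = 2 powr (- \<alpha>) * Gamma ((real DIM('a) - \<alpha>) / 2) / Gamma (real DIM('a) / 2)"
  proof -
    have "(\<integral>y. ((norm y)\<^sup>2 / 2) powr (- (\<alpha> / 2)) \<partial>?\<gamma>) = Gamma ((real DIM('a) - \<alpha>) / 2) / Gamma (real DIM('a) / 2)"
      using moment[of "\<alpha> / 2"] dim \<alpha>
      by (subst integral_eq_nn_integral) (auto intro!: divide_nonneg_pos Gamma_real_pos less_imp_le)
    then show ?thesis by simp
  qed
  have "((\<lambda>x. \<integral>y. D x y \<partial>?\<gamma>) \<longlongrightarrow> (\<integral>y. 2 powr (- \<alpha>) * ((norm y)\<^sup>2 / 2) powr (- (\<alpha> / 2)) \<partial>?\<gamma>)) at_top"
  proof (rule integral_dominated_convergence_at_top[OF _ _ w_int])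
    show "\<forall>\<^sub>F x in at_top. AE y in ?\<gamma>. norm (D x y) \<le> w y"
      using eventually_gt_at_top[of 0]
      by eventually_elim (use y_nz D_bound in \<open>auto elim: eventually_mono\<close>)
    show "AE y in ?\<gamma>. ((\<lambda>x. D x y) \<longlongrightarrow> 2 powr (- \<alpha>) * ((norm y)\<^sup>2 / 2) powr (- (\<alpha> / 2))) at_top"
      using y_nz by eventually_elim (rule D_lim)
  qed auto
  then show "((\<lambda>x. \<integral>y. \<Psi> (inverse (sqrt x)) / \<psi> (sqrt (2 / x) *\<^sub>R y) \<partial>standard_gaussian) \<longlongrightarrow>
          2 powr (- \<alpha>) * Gamma ((real DIM('a) - \<alpha>) / 2) / Gamma (real DIM('a) / 2)) at_top"
    unfolding limit_value D_def .
  fix x :: real assume x: "0 < x"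
  have "integrable ?\<gamma> (D x)"
  proof (rule Bochner_Integration.integrable_bound[OF w_int])
    show "AE y in ?\<gamma>. norm (D x y) \<le> norm (w y)"
      using y_nz by eventually_elim (use D_bound[OF x] in fastforce)
  qed measurable
  then show "integrable ?\<gamma> (\<lambda>y. \<Psi> (inverse (sqrt x)) / \<psi> (sqrt (2 / x) *\<^sub>R y))"
    unfolding D_def .
qed

theorem theorem8:
  fixes M :: "'w measure"
    and X :: "real \<Rightarrow> 'w \<Rightarrow> real ^ 'n"
    and \<psi> :: "real ^ 'n \<Rightarrow> real"
    and \<alpha> :: real
  assumes "CARD('n) \<ge> 3"
    and "isotropic_unimodal_levy_process M X"
    and "levy_khintchine_exponent M X \<psi>"
    and "0 \<le> \<alpha>" "\<alpha> \<le> 2"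
    and "regularly_varying_at_zero \<alpha> (radial_profile \<psi>)"
  shows "((\<lambda>r. ennreal (radial_profile \<psi> (inverse r)) * potential_measure M X {x. norm x \<le> r})
           \<longlongrightarrow> ennreal (2 powr (- \<alpha>) * Gamma ((real CARD('n) - \<alpha>) / 2) / (Gamma (real CARD('n) / 2) * Gamma (1 + \<alpha> / 2))))
         at_top"
proof -
  note uni = assms(2) and \<psi> = assms(3) and rv = assms(6)
  have iso: "isotropic_levy_process M X" and lp: "levy_process M X"
    using uni by (auto simp: isotropic_unimodal_levy_process_def isotropic_levy_process_def)
  let ?\<Psi> = "radial_profile \<psi>" and ?\<gamma> = "standard_gaussian :: (real ^ 'n) measure"
  let ?\<mu> = "radial_potential_measure M X"
  let ?D = "\<lambda>x y. ?\<Psi> (inverse (sqrt x)) / \<psi> (sqrt (2 / x) *\<^sub>R y)"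
  let ?c = "2 powr (- \<alpha>) * Gamma ((real CARD('n) - \<alpha>) / 2) / Gamma (real CARD('n) / 2)"
  have [measurable_cong]: "sets ?\<mu> = sets borel" by (rule sets_radial_potential_measure[OF lp])
  have nonneg: "0 \<le> \<psi> \<xi>" for \<xi> by (rule levy_khintchine_exponent_nonneg[OF lp \<psi>])
  note pos = levy_khintchine_exponent_pos[OF uni \<psi> rv]
  have dim: "3 \<le> DIM(real ^ 'n)" using assms(1) by simp
  note average = gaussian_average_inverse_regularly_varying[OF dim assms(5)
      levy_khintchine_exponent_measurable[OF lp \<psi>]
      levy_khintchine_exponent_eq_radial_profile[OF iso \<psi>] pos
      levy_khintchine_exponent_almost_increasing[OF uni \<psi>] _ rv]
  have D_int: "integrable ?\<gamma> (?D x)" if "0 < x" for x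
    using average(1)[OF _ _ _ that] by simp
  have D_lim: "((\<lambda>x. \<integral>y. ?D x y \<partial>?\<gamma>) \<longlongrightarrow> ?c) at_top"
    using average(2) by simp
  define h where "h x = inverse (?\<Psi> (inverse (sqrt x)))" for x
  have h: "regularly_varying_at_infinity (\<alpha> / 2) h"
    using regularly_varying_at_infinity_sqrt[OF rv[unfolded regularly_varying_at_zero_def]]
    unfolding h_def[abs_def] .
  have h_pos: "\<forall>\<^sub>F x in at_top. 0 < h x"
    using h unfolding regularly_varying_at_infinity_def eventually_at_top_linorder by blast
  have laplace: "integrable ?\<mu> (\<lambda>s. exp (- (s / x)))" "(\<integral>s. exp (- (s / x)) \<partial>?\<mu>) / h x = (\<integral>y. ?D x y \<partial>?\<gamma>)"
    if x: "0 < x" "0 < h x" for x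
  proof -
    have D0: "0 \<le> ?D x y" for y
      using x(2) nonneg by (simp add: h_def)
    have "(\<integral>\<^sup>+s. ennreal (exp (- (s / x))) \<partial>?\<mu>) = (\<integral>\<^sup>+y. ennreal (1 / \<psi> (sqrt (2 / x) *\<^sub>R y)) \<partial>?\<gamma>)"
      using radial_potential_measure_laplace[OF lp \<psi> pos, of "1 / x"] x by simp
    also have "\<dots> = (\<integral>\<^sup>+y. ennreal (h x * ?D x y) \<partial>?\<gamma>)"
      using x by (simp add: h_def)
    also have "\<dots> = ennreal (\<integral>y. h x * ?D x y \<partial>?\<gamma>)"
      using x(2) D0 by (intro nn_integral_eq_integral integrable_mult_right D_int[OF x(1)] AE_I2 mult_nonneg_nonneg) auto
    finally have *: "(\<integral>\<^sup>+s. ennreal (exp (- (s / x))) \<partial>?\<mu>) = ennreal (h x * (\<integral>y. ?D x y \<partial>?\<gamma>))"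
      by (simp only: integral_mult_right_zero)
    show "integrable ?\<mu> (\<lambda>s. exp (- (s / x)))"
      by (rule integrableI_nonneg) (auto simp: *)
    have "0 \<le> (\<integral>y. ?D x y \<partial>?\<gamma>)"
      using D0 by (intro integral_nonneg_AE AE_I2)
    then have "(\<integral>s. exp (- (s / x)) \<partial>?\<mu>) = h x * (\<integral>y. ?D x y \<partial>?\<gamma>)"
      unfolding integral_eq_nn_integral[of "\<lambda>s. exp (- (s / x))" ?\<mu>, simplified] *
      using x(2) by (intro enn2real_ennreal mult_nonneg_nonneg) auto
    then show "(\<integral>s. exp (- (s / x)) \<partial>?\<mu>) / h x = (\<integral>y. ?D x y \<partial>?\<gamma>)" using x by simp
  qed
  have "((\<lambda>x. measure ?\<mu> {..x} / h x) \<longlongrightarrow> ?c / Gamma (1 + \<alpha> / 2)) at_top"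
  proof (rule karamata_tauberian[OF sets_radial_potential_measure[OF lp] _ _ h])
    show "AE s in ?\<mu>. 0 \<le> s"
    proof (rule AE_I)
      have "emeasure ?\<mu> {..<0} = (\<integral>\<^sup>+s. indicator {..<0} s \<partial>?\<mu>)" by simp
      also have "\<dots> = (\<integral>\<^sup>+t\<in>{0..}. (\<integral>\<^sup>+x. indicator {..<0} ((norm x)\<^sup>2) \<partial>distr M borel (X t)) \<partial>lborel)"
        by (rule nn_integral_radial_potential_measure[OF lp]) measurable
      finally show "emeasure ?\<mu> {..<0} = 0" by simp
    qed auto
    show "\<forall>\<^sub>F x in at_top. integrable ?\<mu> (\<lambda>s. exp (- (s / x)))"
      using h_pos eventually_gt_at_top[of 0] by eventually_elim (rule laplace(1))
    show "((\<lambda>x. (\<integral>s. exp (- (s / x)) \<partial>?\<mu>) / h x) \<longlongrightarrow> ?c) at_top"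
      by (rule Lim_transform_eventually[OF D_lim])
        (use h_pos eventually_gt_at_top[of 0] in eventually_elim, simp only: laplace(2))
  qed (use assms(4) in simp)
  then have "((\<lambda>r. measure ?\<mu> {..r\<^sup>2} / h (r\<^sup>2)) \<longlongrightarrow> ?c / Gamma (1 + \<alpha> / 2)) at_top"
    by (rule filterlim_compose) (rule filterlim_pow_at_top[OF _ filterlim_ident], simp)
  then have "((\<lambda>r. ennreal (measure ?\<mu> {..r\<^sup>2} / h (r\<^sup>2))) \<longlongrightarrow> ennreal (?c / Gamma (1 + \<alpha> / 2))) at_top"
    by (rule tendsto_ennrealI)
  moreover have "\<forall>\<^sub>F r in at_top. ennreal (measure ?\<mu> {..r\<^sup>2} / h (r\<^sup>2))
      = ennreal (?\<Psi> (inverse r)) * potential_measure M X {x. norm x \<le> r}"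
    using eventually_gt_at_top[of 0]
  proof eventually_elim
    case (elim r)
    then have r: "0 < r" by simp
    have "?\<Psi> (inverse r) = \<psi> (inverse r *\<^sub>R axis undefined 1)"
      using r by (simp add: levy_khintchine_exponent_eq_radial_profile[OF iso \<psi>])
    then have "0 < ?\<Psi> (inverse r)" using r by (simp add: pos)
    then have hr: "h (r\<^sup>2) = inverse (?\<Psi> (inverse r))" "0 < h (r\<^sup>2)"
      using r by (auto simp: h_def)
    \<comment> \<open>The potential of the ball is finite because the Laplace transform of \<open>?\<mu>\<close> at \<open>1 / r\<^sup>2\<close> is.\<close>
    have "emeasure ?\<mu> {..r\<^sup>2} = (\<integral>\<^sup>+s. indicator {..r\<^sup>2} s \<partial>?\<mu>)" by simp
    also have "\<dots> \<le> (\<integral>\<^sup>+s. ennreal (exp 1 * exp (- (s / r\<^sup>2))) \<partial>?\<mu>)"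
      using r by (intro nn_integral_mono) (auto simp: indicator_def exp_add[symmetric] divide_simps simp flip: ennreal_1)
    also have "\<dots> < \<infinity>"
      using laplace(1)[of "r\<^sup>2"] r hr by (subst nn_integral_eq_integral) auto
    finally have "emeasure ?\<mu> {..r\<^sup>2} = ennreal (measure ?\<mu> {..r\<^sup>2})"
      by (intro emeasure_eq_ennreal_measure) auto
    then have "potential_measure M X {x. norm x \<le> r} = ennreal (measure ?\<mu> {..r\<^sup>2})"
      using potential_measure_cball_eq[OF lp, of r] r by simp
    then show ?case
      using hr by (simp add: divide_inverse ennreal_mult'[symmetric] mult.commute)
  qed
  ultimately have "((\<lambda>r. ennreal (?\<Psi> (inverse r)) * potential_measure M X {x. norm x \<le> r})
      \<longlongrightarrow> ennreal (?c / Gamma (1 + \<alpha> / 2))) at_top"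
    by (rule Lim_transform_eventually)
  then show ?thesis by simp
qed

end
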